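(* Let $(B_t)_{0\le t\le1}$ be $d$-dimensional Brownian motion started at $0$, and for $\sigma>0$ let $$S_\sigma=\int_0^1dt_1\int_0^1dt_2\;g_\sigma(B_{t_1}-B_{t_2}),\qquad g_\sigma(y)=\exp\left(-|y|^2/2\sigma^2\right),\ y\in\mathbf R^d.$$ For $d\ge3$, $$\frac{S_\sigma}{\sigma^2}\to\frac4{d-2}\qquad\text{as }\sigma\downarrow0,\ \text{almost surely}.$$ In dimension $d=2$, $$\frac{S_\sigma}{\sigma^2\log\frac1\sigma}\to4\qquad\text{as }\sigma\downarrow0,\ \text{almost surely}.$$
   Context: $|\cdot|$ denotes the Euclidean norm on $\mathbf R^d$. *)

theory Defs
  imports "HOL-Probability.Probability"
begin

(* Only times in {0..1} matter; B is unconstrained outside that interval. Continuity of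
   paths and the starting point are required almost surely. The density is that of the
   centred Gaussian law on R^d with covariance matrix (t - s) times the identity. *)
locale brownian_motion = prob_space M
  for M :: "'w measure" and B :: "real \<Rightarrow> 'w \<Rightarrow> real ^ 'd" +
  assumes measurable_at: "\<And>t. t \<in> {0..1} \<Longrightarrow> B t \<in> borel_measurable M"
    and start_zero: "AE \<omega> in M. B 0 \<omega> = 0"
    and continuous_paths: "AE \<omega> in M. continuous_on {0..1} (\<lambda>t. B t \<omega>)"
    and gaussian_increments: "\<And>s t. 0 \<le> s \<Longrightarrow> s < t \<Longrightarrow> t \<le> 1 \<Longrightarrow>
      distributed M lborel (\<lambda>\<omega>. B t \<omega> - B s \<omega>)
        (\<lambda>x. ennreal ((2 * pi * (t - s)) powr (- real CARD('d) / 2)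
                        * exp (- (norm x)\<^sup>2 / (2 * (t - s)))))"
    and independent_increments: "\<And>(n :: nat) (\<tau> :: nat \<Rightarrow> real).
      0 \<le> \<tau> 0 \<Longrightarrow> (\<And>i. i < n \<Longrightarrow> \<tau> i < \<tau> (Suc i)) \<Longrightarrow> \<tau> n \<le> 1 \<Longrightarrow>
      indep_vars (\<lambda>_. borel) (\<lambda>i \<omega>. B (\<tau> (Suc i)) \<omega> - B (\<tau> i) \<omega>) {..<n}"

definition gauss :: "real \<Rightarrow> real ^ 'd \<Rightarrow> real" where
  "gauss \<sigma> y = exp (- (norm y)\<^sup>2 / (2 * \<sigma>\<^sup>2))"

definition self_overlap :: "(real \<Rightarrow> 'w \<Rightarrow> real ^ 'd) \<Rightarrow> real \<Rightarrow> 'w \<Rightarrow> real" where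
  "self_overlap B \<sigma> \<omega> =
     (LINT t\<^sub>1:{0..1}|lborel. (LINT t\<^sub>2:{0..1}|lborel. gauss \<sigma> (B t\<^sub>1 \<omega> - B t\<^sub>2 \<omega>)))"

end

theory Submission
  imports Defs "HOL-Real_Asymp.Real_Asymp"
begin

text \<open>
  Write h for the square of \<sigma>. The mean of S is an explicit integral of
  (h / (h + u)) powr (d / 2), and Var S is O(h^2) for d = 2 and O(h^(9/4)) for d \<ge> 3. For the
  variance, pairs of disjoint time intervals are uncorrelated; for interlaced and nested pairs
  the joint moment is an explicit Gaussian determinant, and AM-GM bounds the covariance by
  a power of h times (a b c) powr (-5/6), where a, b, c are the three consecutive gaps between the four times. This
  is integrable over the unit cube. Only for nested pairs with d = 2 does one need the cancellation
  from subtracting the product of the means: without it the variance carries an additional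
  logarithm and the sums below diverge. Hence the normalised variances are summable along every
  sequence \<sigma> = q^n, which gives almost sure convergence along it; S is monotone in \<sigma>, so letting
  q tend to 1 fills the gaps.
\<close>

section \<open>Gaussian smoothing\<close>

text \<open>In each coordinate the increments over two time intervals form a centred Gaussian pair.
  Their joint moment is (h^2 / D) powr (d / 2), with D the determinant of the covariance matrix plus
  h times the identity. The product of the diagonal entries alone would give the product of the
  means; the off-diagonal entry is the length b of the overlap, so correlation enters only through
  the b^2 subtracted in D. For nested intervals and d = 2, h^2 / D is close to h^2 / ((a + c) * (h +
  b)) when h is small, and integrating over b costs a logarithm. Subtracting the product of the
  means brings in a numerator b^2, which removes the singularity in b and leaves 1 / ((a + c) * (a +
  b + c)). Bounding a + c and a + b + c below by geometric means gives 1/2 + 1/3 = 5/6, the exponent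
  used throughout. For d \<ge> 3 the exponent 3/2 leaves room: half of (h + b) powr (-3/2) is spent
  on h, which turns h^3 into h^(9/4). Everything up to the second moment is done with nonnegative
  extended integrals, so interchanging them requires measurability only; the square of the mean is
  subtracted after the passage to reals.\<close>

definition bump :: "real \<Rightarrow> real ^ 'd \<Rightarrow> real" where
  "bump \<tau> y = exp (- (norm y)\<^sup>2 / (2 * \<tau>))"

definition gauss_law :: "real \<Rightarrow> (real ^ 'd) measure" where
  "gauss_law v = density lborel (\<lambda>x. ennreal ((2 * pi * v) powr (- real CARD('d) / 2)
                        * exp (- (norm x)\<^sup>2 / (2 * v))))"

lemma sets_gauss_law [simp, measurable_cong]: "sets (gauss_law v) = sets borel"
  by (simp add: gauss_law_def)

lemma space_gauss_law [simp]: "space (gauss_law v) = UNIV"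
  by (simp add: gauss_law_def)

lemma borel_measurable_bump [measurable]: "bump \<tau> \<in> borel_measurable borel"
  unfolding bump_def by measurable

lemma bump_nonneg [simp]: "0 \<le> bump \<tau> y"
  by (simp add: bump_def)

lemma gauss_eq_bump: "gauss \<sigma> = bump (\<sigma>\<^sup>2)"
  by (simp add: gauss_def bump_def fun_eq_iff)

text \<open>The exponential is \<open>sqrt (2 * pi * \<tau>)\<close> times the normal density of
  variance \<tau> at - y - x, so this is a convolution of two centred normal densities at - y, where
  the variances add.\<close>

lemma nn_integral_bump_normal_real:
  assumes "\<tau> > 0" "v > 0"
  shows "(\<integral>\<^sup>+ x. ennreal (exp (- (x + y)\<^sup>2 / (2 * \<tau>)) * normal_density 0 (sqrt v) x) \<partial>lborel)
       = ennreal (sqrt (\<tau> / (\<tau> + v)) * exp (- y\<^sup>2 / (2 * (\<tau> + v))))"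
proof -
  have "(\<integral>\<^sup>+ x. ennreal (exp (- (x + y)\<^sup>2 / (2 * \<tau>)) * normal_density 0 (sqrt v) x) \<partial>lborel)
      = (\<integral>\<^sup>+ x. ennreal (sqrt (2 * pi * \<tau>)) * ennreal (normal_density 0 (sqrt \<tau>) (- y - x) * normal_density 0 (sqrt v) x) \<partial>lborel)"
    using assms
    by (intro nn_integral_cong)
       (simp add: ennreal_mult'[symmetric] normal_density_def power2_eq_square field_simps)
  also have "\<dots> = ennreal (sqrt (2 * pi * \<tau>)) * ennreal (normal_density 0 (sqrt (\<tau> + v)) (- y))"
    using fun_cong[OF conv_normal_density_zero_mean[of "sqrt \<tau>" "sqrt v"], of "- y"] assms
    by (subst nn_integral_cmult) auto
  also have "\<dots> = ennreal (sqrt (\<tau> / (\<tau> + v)) * exp (- y\<^sup>2 / (2 * (\<tau> + v))))"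
    using assms
    by (simp add: ennreal_mult'[symmetric] normal_density_def real_sqrt_mult real_sqrt_divide)
  finally show ?thesis .
qed

lemma norm_sq_sum_Basis: "(norm x)\<^sup>2 = (\<Sum>b\<in>Basis. (x \<bullet> b)\<^sup>2)"
  for x :: "'a::euclidean_space"
  by (subst power2_norm_eq_inner, subst euclidean_inner) (simp add: power2_eq_square)

lemma powr_card_eq_prod:
  assumes "c > 0"
  shows "c powr (real CARD('d) / 2) = (\<Prod>b\<in>(Basis :: (real^'d) set). sqrt c)"
  using assms by (simp add: powr_half_sqrt[symmetric] powr_powr mult.commute flip: powr_realpow)

text \<open>Both Gaussians are products over the coordinates, so the one-dimensional formula applies
  to each factor. Parametrising \<open>bump\<close> by a variance makes smoothing additive in the
  parameter; the moments of increments below come from repeated use of this rule.\<close>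

lemma nn_integral_bump_gauss_law:
  fixes y :: "real ^ 'd"
  assumes "\<tau> > 0" "v > 0"
  shows "(\<integral>\<^sup>+ x. ennreal (bump \<tau> (x + y)) \<partial>gauss_law v)
       = ennreal ((\<tau> / (\<tau> + v)) powr (real CARD('d) / 2) * bump (\<tau> + v) y)"
proof -
  let ?B = "Basis :: (real^'d) set"
  have exp_prod: "exp (- (norm x)\<^sup>2 / (2 * c)) = (\<Prod>b\<in>?B. exp (- (x \<bullet> b)\<^sup>2 / (2 * c)))" for x c
    by (simp add: norm_sq_sum_Basis sum_negf sum_divide_distrib flip: exp_sum)
  have bump_prod: "bump c x = (\<Prod>b\<in>?B. exp (- (x \<bullet> b)\<^sup>2 / (2 * c)))" for x c
    by (simp only: bump_def exp_prod)
  have dens: "(2 * pi * v) powr (- real CARD('d) / 2) * exp (- (norm x)\<^sup>2 / (2 * v))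
     = (\<Prod>b\<in>?B. normal_density 0 (sqrt v) (x \<bullet> b))" for x :: "real^'d"
  proof -
    have "(2 * pi * v) powr (- real CARD('d) / 2) = (1 / (2 * pi * v)) powr (real CARD('d) / 2)"
      using assms by (simp add: powr_minus_divide powr_divide powr_mult)
    also have "\<dots> = (\<Prod>b\<in>?B. sqrt (1 / (2 * pi * v)))"
      using assms by (intro powr_card_eq_prod) simp
    finally have e: "(2 * pi * v) powr (- real CARD('d) / 2) = (\<Prod>b\<in>?B. sqrt (1 / (2 * pi * v)))" .
    show ?thesis unfolding e exp_prod prod.distrib[symmetric]
      using assms by (intro prod.cong) (simp_all add: normal_density_def real_sqrt_divide)
  qed
  have "(\<integral>\<^sup>+ x. ennreal (bump \<tau> (x + y)) \<partial>gauss_law v)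
    = (\<integral>\<^sup>+ x. (\<Prod>b\<in>?B. ennreal (exp (- (x \<bullet> b + y \<bullet> b)\<^sup>2 / (2 * \<tau>)) * normal_density 0 (sqrt v) (x \<bullet> b))) \<partial>lborel)"
    unfolding gauss_law_def dens bump_prod
    by (subst nn_integral_density)
       (auto intro!: nn_integral_cong simp: ennreal_mult'[symmetric] prod_nonneg prod_ennreal prod.distrib inner_add_left mult.commute)
  also have "\<dots> = (\<Prod>b\<in>?B. (\<integral>\<^sup>+ x. ennreal (exp (- (x + y \<bullet> b)\<^sup>2 / (2 * \<tau>)) * normal_density 0 (sqrt v) x) \<partial>lborel))"
    by (rule nn_integral_lborel_prod) auto
  also have "\<dots> = (\<Prod>b\<in>?B. ennreal (sqrt (\<tau> / (\<tau> + v)) * exp (- (y \<bullet> b)\<^sup>2 / (2 * (\<tau> + v)))))"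
    using assms by (intro prod.cong refl nn_integral_bump_normal_real)
  also have "\<dots> = ennreal ((\<tau> / (\<tau> + v)) powr (real CARD('d) / 2) * bump (\<tau> + v) y)"
    unfolding bump_def exp_prod using assms by (subst powr_card_eq_prod) (simp_all add: prod_ennreal prod.distrib)
  finally show ?thesis .
qed

text \<open>Precisions add: the parameter on the right is the inverse of 1 / \<alpha> + 1 /
  \<gamma>. This merges the two factors in the shared increment that remain once the outer
  increments are integrated out.\<close>

lemma bump_mult:
  assumes "\<alpha> > 0" "\<gamma> > 0"
  shows "bump \<alpha> y * bump \<gamma> y = bump (\<alpha> * \<gamma> / (\<alpha> + \<gamma>)) y"
  using assms by (simp add: bump_def field_simps flip: exp_add)

section \<open>The joint law of three consecutive increments\<close>

context brownian_motion begin

text \<open>Independence makes the joint law a product of three Gaussians. The middle increment y is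
  integrated last because it is the one shared by two overlapping intervals: for fixed y, the
  variables x and z can be smoothed out separately.\<close>

lemma nn_integral_increments3:
  assumes "0 \<le> a" "a < b" "b < c" "c < e" "e \<le> 1"
  assumes [measurable]: "case_prod (\<lambda>x. case_prod (\<phi> x)) \<in> borel_measurable (borel \<Otimes>\<^sub>M borel \<Otimes>\<^sub>M borel)"
  shows "(\<integral>\<^sup>+ \<omega>. \<phi> (B b \<omega> - B a \<omega>) (B c \<omega> - B b \<omega>) (B e \<omega> - B c \<omega>) \<partial>M)
     = (\<integral>\<^sup>+ y. \<integral>\<^sup>+ z. \<integral>\<^sup>+ x. \<phi> x y z \<partial>gauss_law (b - a) \<partial>gauss_law (e - c) \<partial>gauss_law (c - b))"
proof -
  \<comment> \<open>The value e repeats from index 3 on, so that \<open>X i\<close> is a random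
    variable and \<open>L i\<close> a probability measure for every i, as
    \<open>product_prob_space\<close> demands.\<close>
  define \<tau> where "\<tau> = (\<lambda>i::nat. if i = 0 then a else if i = 1 then b else if i = 2 then c else e)"
  have \<tau>lt: "\<tau> i < \<tau> (Suc i)" if "i < 3" for i
    using that assms by (auto simp: \<tau>_def numeral_3_eq_3 less_Suc_eq)
  define X where "X = (\<lambda>i \<omega>. B (\<tau> (Suc i)) \<omega> - B (\<tau> i) \<omega>)"
  define L where "L = (\<lambda>i. distr M borel (X i))"
  have \<tau>in: "\<tau> i \<in> {0..1}" for i using assms by (auto simp: \<tau>_def)
  have [measurable]: "X i \<in> borel_measurable M" for i
    using measurable_at[OF \<tau>in[of i]] measurable_at[OF \<tau>in[of "Suc i"]] by (simp add: X_def)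
  have "indep_vars (\<lambda>_. borel) X {..<3}"
    unfolding X_def using independent_increments[of \<tau> 3] \<tau>lt \<tau>in[of 0] \<tau>in[of 3] by auto
  then have dist: "distr M (\<Pi>\<^sub>M i\<in>{..<3}. borel) (\<lambda>\<omega>. \<lambda>i\<in>{..<3}. X i \<omega>) = (\<Pi>\<^sub>M i\<in>{..<3}. L i)"
    unfolding L_def by (subst (asm) indep_vars_iff_distr_eq_PiM) (auto simp: lessThan_empty_iff)
  have sL[measurable_cong]: "sets (L i) = sets borel" for i by (simp add: L_def)
  have Leq: "L i = gauss_law (\<tau> (Suc i) - \<tau> i)" if "i < 3" for i
  proof -
    have "distributed M lborel (X i) (\<lambda>x. ennreal ((2 * pi * (\<tau> (Suc i) - \<tau> i)) powr (- real CARD('d) / 2)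
                        * exp (- (norm x)\<^sup>2 / (2 * (\<tau> (Suc i) - \<tau> i)))))"
      unfolding X_def using gaussian_increments[of "\<tau> i" "\<tau> (Suc i)"] \<tau>lt[OF that] \<tau>in[of i] \<tau>in[of "Suc i"] by auto
    from distributed_distr_eq_density[OF this] show ?thesis
      unfolding gauss_law_def L_def by (simp cong: distr_cong)
  qed
  interpret L: prob_space "L i" for i unfolding L_def by (rule prob_space_distr) simp
  interpret P: product_prob_space L "{..<3}" by standard
  have comp: "(\<lambda>f. f i) \<in> measurable (Pi\<^sub>M J L) borel" if "i \<in> J" for i :: nat and J
    using measurable_component_singleton[of i J L] that by (simp cong: measurable_cong_sets add: sL)
  have \<phi>m: "(\<lambda>w. \<phi> (f w) (g w) (k w)) \<in> borel_measurable N"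
    if "f \<in> borel_measurable N" "g \<in> borel_measurable N" "k \<in> borel_measurable N" for N :: "'z measure" and f g k
    using measurable_compose[OF measurable_Pair[OF that(1) measurable_Pair[OF that(2,3)]] assms(6)] by simp
  have m: "(\<lambda>f. \<phi> (f 0) (f 1) (f 2)) \<in> borel_measurable (\<Pi>\<^sub>M i\<in>{0,1,2::nat}. borel :: (real^'d) measure)"
  proof -
    have [measurable]: "(\<lambda>f. f i) \<in> measurable (\<Pi>\<^sub>M i\<in>{0,1,2::nat}. borel :: (real^'d) measure) borel" if "i \<in> {0,1,2}" for i::nat
      using that by (rule measurable_component_singleton)
    have "(\<lambda>f. (f 0, f 1, f 2)) \<in> measurable (\<Pi>\<^sub>M i\<in>{0,1,2::nat}. borel :: (real^'d) measure) (borel \<Otimes>\<^sub>M borel \<Otimes>\<^sub>M borel)"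
      by (intro measurable_Pair measurable_component_singleton) auto
    from measurable_compose[OF this assms(6)] show ?thesis by simp
  qed
  have sP: "sets (Pi\<^sub>M {0,1,2::nat} L) = sets (Pi\<^sub>M {0,1,2} (\<lambda>i. borel))"
    by (rule sets_PiM_cong) (auto simp: sL)
  have I: "{..<3} = {0,1,2::nat}" by auto
  have "(\<integral>\<^sup>+ \<omega>. \<phi> (B b \<omega> - B a \<omega>) (B c \<omega> - B b \<omega>) (B e \<omega> - B c \<omega>) \<partial>M)
      = (\<integral>\<^sup>+ \<omega>. (\<lambda>f. \<phi> (f 0) (f 1) (f 2)) (\<lambda>i\<in>{..<3}. X i \<omega>) \<partial>M)"
    by (simp add: X_def \<tau>_def)
  also have "\<dots> = (\<integral>\<^sup>+ f. \<phi> (f 0) (f 1) (f 2) \<partial>distr M (\<Pi>\<^sub>M i\<in>{..<3}. borel) (\<lambda>\<omega>. \<lambda>i\<in>{..<3}. X i \<omega>))"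
    using m unfolding I by (subst nn_integral_distr) (auto)
  \<comment> \<open>The index set is listed as 1, 2, 0 so that peeling off one coordinate at a time
    leaves the middle increment outermost.\<close>
  also have "\<dots> = (\<integral>\<^sup>+ f. \<phi> (f 0) (f 1) (f 2) \<partial>Pi\<^sub>M {1,2,0} L)"
    unfolding dist[unfolded I] I by (simp add: insert_commute)
  also have "\<dots> = (\<integral>\<^sup>+ y. \<integral>\<^sup>+ f. \<phi> (f 0) y (f 2) \<partial>Pi\<^sub>M {2,0} L \<partial>L 1)"
    using m by (subst P.product_nn_integral_insert_rev) (auto simp: insert_commute sP cong: measurable_cong_sets)
  also have "\<dots> = (\<integral>\<^sup>+ y. \<integral>\<^sup>+ z. \<integral>\<^sup>+ f. \<phi> (f 0) y z \<partial>Pi\<^sub>M {0} L \<partial>L 2 \<partial>L 1)"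
    by (intro nn_integral_cong, subst P.product_nn_integral_insert_rev) (auto intro!: \<phi>m comp)
  also have "\<dots> = (\<integral>\<^sup>+ y. \<integral>\<^sup>+ z. \<integral>\<^sup>+ x. \<phi> x y z \<partial>L 0 \<partial>L 2 \<partial>L 1)"
    by (intro nn_integral_cong, subst P.product_nn_integral_singleton) (auto intro!: \<phi>m measurable_ident_sets sL)
  also have "\<dots> = (\<integral>\<^sup>+ y. \<integral>\<^sup>+ z. \<integral>\<^sup>+ x. \<phi> x y z \<partial>gauss_law (b - a) \<partial>gauss_law (e - c) \<partial>gauss_law (c - b))"
    by (simp add: Leq) (simp add: \<tau>_def)
  finally show ?thesis .
qed

end

section \<open>Joint moments of the increments\<close>

lemma bump_0 [simp]: "bump \<tau> 0 = 1"
  by (simp add: bump_def)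

lemma bump_le_1: "\<tau> > 0 \<Longrightarrow> bump \<tau> y \<le> 1"
  by (simp add: bump_def)

lemma bump_minus [simp]: "bump \<tau> (- y) = bump \<tau> y"
  by (simp add: bump_def)

section \<open>Elementary bounds on the Gaussian determinants\<close>

lemma powr_third_le_add:
  fixes u v w :: real
  assumes "u > 0" "v > 0" "w > 0"
  shows "(u * v * w) powr (1/3) \<le> u + v + w"
proof -
  have "u * v * w \<le> (u + v + w) * (u + v + w) * (u + v + w)"
    using assms by (intro mult_mono) auto
  also have "\<dots> = (u + v + w) powr 3"
    using assms by (simp add: powr_numeral power3_eq_cube)
  finally have "(u * v * w) powr (1/3) \<le> ((u + v + w) powr 3) powr (1/3)"
    using assms by (intro powr_mono2) auto
  then show ?thesis using assms by (simp only: powr_powr) simp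
qed

lemma powr_half_le_add:
  fixes u v :: real
  assumes "u > 0" "v > 0"
  shows "(u * v) powr (1/2) \<le> u + v"
proof -
  have "u * v \<le> (u + v) * (u + v)"
    using assms by (intro mult_mono) auto
  also have "\<dots> = (u + v) powr 2"
    using assms by (simp add: powr_numeral power2_eq_square)
  finally have "(u * v) powr (1/2) \<le> ((u + v) powr 2) powr (1/2)"
    using assms by (intro powr_mono2) auto
  then show ?thesis using assms by (simp only: powr_powr) simp
qed

lemma powr_mult3:
  fixes x y z :: real
  assumes "0 \<le> x" "0 \<le> y" "0 \<le> z"
  shows "(x * y * z) powr p = x powr p * y powr p * z powr p"
  using assms by (simp add: powr_mult)

text \<open>The denominator equals (h + a + b) * (h + b + c) - b^2. It dominates h^2, so the
  exponent p may be lowered to q; it also dominates a * b + b * c + c * a, hence (a * b * c) powr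
  (2/3) by AM-GM for these three products. The resulting power -2q/3 is at least -5/6 because q
  \<le> 5/4.\<close>

lemma interleaved_bound:
  fixes a b c h p q :: real
  assumes "0 < a" "a \<le> 1" "0 < b" "b \<le> 1" "0 < c" "c \<le> 1" "0 < h" and q: "0 < q" "q \<le> p" "q \<le> 5/4"
  shows "(h\<^sup>2 / ((h + a) * (h + c) + b * (2 * h + a + c))) powr p
      \<le> h powr (2 * q) * (a * b * c) powr (-5/6)"
proof -
  define D where "D = (h + a) * (h + c) + b * (2 * h + a + c)"
  have "D = h\<^sup>2 + (h * (a + c) + 2 * b * h) + (a * b + b * c + c * a)"
    by (simp add: D_def algebra_simps power2_eq_square)
  moreover have "0 \<le> h * (a + c) + 2 * b * h" "0 < a * b + b * c + c * a"
    using assms by (auto intro!: add_nonneg_nonneg add_pos_pos)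
  ultimately have D: "h\<^sup>2 \<le> D" "a * b + b * c + c * a \<le> D" "0 < D"
    using zero_le_power2[of h] by linarith+
  have abc: "0 < a * b * c" "a * b * c \<le> 1"
    using assms by (auto intro!: mult_le_one)
  have "(a * b * c) powr (2/3) = ((a * b) * (b * c) * (c * a)) powr (1/3)"
  proof -
    have "(a * b) * (b * c) * (c * a) = (a * b * c) powr 2"
      using assms by (simp add: powr_numeral power2_eq_square)
    then show ?thesis by (simp add: powr_powr)
  qed
  also have "\<dots> \<le> D"
    using powr_third_le_add[of "a * b" "b * c" "c * a"] D(2) assms by simp
  finally have D': "(a * b * c) powr (2/3) \<le> D" .
  have "(h\<^sup>2 / D) powr p \<le> (h\<^sup>2 / D) powr q"
    using D assms by (intro powr_mono') auto
  also have "\<dots> = h powr (2 * q) * D powr (- q)"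
    using assms D by (simp add: powr_divide powr_minus_divide powr_powr flip: powr_numeral)
  also have "D powr (- q) \<le> ((a * b * c) powr (2/3)) powr (- q)"
    using D' abc assms by (intro powr_mono2') auto
  also have "\<dots> \<le> (a * b * c) powr (-5/6)"
    using abc q unfolding powr_powr by (intro powr_mono') auto
  finally show ?thesis by (simp add: D_def mult_left_mono)
qed

text \<open>After lowering p to 3/2, the factor (h + b) powr (-3/2) is split into two equal powers,
  one bounded through h and one through b. Giving all of it to b would not be integrable, giving all
  of it to h would leave only h powr (3/2); the split costs h powr (-3/4) and keeps h powr (3 -
  3/4).\<close>

lemma nested_bound_ge3:
  fixes a b c h p :: real
  assumes "0 < a" "a \<le> 1" "0 < b" "b \<le> 1" "0 < c" "c \<le> 1" "0 < h" and p: "3/2 \<le> p"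
  shows "(h\<^sup>2 / ((h + (a + c)) * (h + b) + h * b)) powr p
      \<le> h powr (9/4) * (a * b * c) powr (-5/6)"
proof -
  define D where "D = (h + (a + c)) * (h + b) + h * b"
  have D: "(h + (a + c)) * (h + b) \<le> D" "h * h \<le> (h + (a + c)) * (h + b)" "0 < (h + (a + c)) * (h + b)"
    using assms by (auto simp: D_def intro!: mult_mono)
  have abc: "0 < a * b * c" "a * b * c \<le> 1"
    using assms by (auto intro!: mult_le_one)
  have "h\<^sup>2 \<le> D" "0 < D" using D by (auto simp: power2_eq_square)
  then have "(h\<^sup>2 / D) powr p \<le> (h\<^sup>2 / D) powr (3/2)"
    using assms by (intro powr_mono') auto
  also have "\<dots> \<le> (h\<^sup>2 / ((h + (a + c)) * (h + b))) powr (3/2)"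
    using D by (intro powr_mono2 divide_left_mono) auto
  also have "\<dots> = h powr 3 * ((h + (a + c)) powr (- 3/2) * ((h + b) powr (- 3/4) * (h + b) powr (- 3/4)))"
    using assms by (simp add: powr_divide powr_mult powr_minus_divide powr_powr flip: powr_numeral powr_add)
  also have "\<dots> \<le> h powr 3 * (((a * c) powr (1/2)) powr (- 3/2) * (h powr (- 3/4) * b powr (- 3/4)))"
    using powr_half_le_add[of a c] assms by (intro mult_left_mono, intro mult_mono powr_mono2') auto
  also have "\<dots> = h powr (9/4) * (a * b * c) powr (-3/4)"
  proof -
    have "h powr 3 * h powr (- 3/4) = h powr (9/4)" by (simp flip: powr_add)
    moreover have "((a * c) powr (1/2)) powr (- 3/2) * b powr (- 3/4) = (a * b * c) powr (-3/4)"
      using assms by (simp add: powr_powr powr_mult)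
    moreover have "w * (x * (y * z)) = (w * y) * (x * z)" for w x y z :: real by simp
    ultimately show ?thesis by (simp only:)
  qed
  also have "\<dots> \<le> h powr (9/4) * (a * b * c) powr (-5/6)"
    using abc by (intro mult_left_mono powr_mono') auto
  finally show ?thesis by (simp add: D_def)
qed

text \<open>With P and Q the denominators of the joint moment and of the product of the means, Q - P
  = b^2, so the difference of reciprocals is b^2 / (P * Q). The final bound stems from (a + c) * (a
  + b + c) \<ge> (a * c) powr (1/2) * (a * b * c) powr (1/3), which carries the power 5/6 of a and
  c.\<close>

lemma nested_bound_2:
  fixes a b c h :: real
  assumes "0 < a" "a \<le> 1" "0 < b" "b \<le> 1" "0 < c" "c \<le> 1" "0 < h"
  shows "h\<^sup>2 / ((h + (a + c)) * (h + b) + h * b)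
      \<le> (h / (h + (a + b + c))) * (h / (h + b)) + h\<^sup>2 * (a * b * c) powr (-5/6)"
proof -
  define P where "P = (h + (a + c)) * (h + b) + h * b"
  define Q where "Q = (h + (a + b + c)) * (h + b)"
  have pos: "0 < P" "0 < Q" using assms by (auto simp: P_def Q_def intro!: add_pos_pos mult_pos_pos)
  have abc: "0 < a * b * c" using assms by auto
  \<comment> \<open>Each of P and Q keeps one factor b, and together these absorb the numerator
    b^2.\<close>
  have ge: "((a + c) * b) * ((a + b + c) * b) \<le> P * Q"
    unfolding P_def Q_def using assms
    by (intro mult_mono) (auto simp: algebra_simps)
  have "Q - P = b\<^sup>2" by (simp add: P_def Q_def algebra_simps power2_eq_square)
  then have "1 / P - 1 / Q = b\<^sup>2 / (P * Q)" using pos by (simp add: field_simps)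
  also have "\<dots> \<le> b\<^sup>2 / (((a + c) * b) * ((a + b + c) * b))"
    using ge pos assms by (intro divide_left_mono mult_pos_pos add_pos_pos) auto
  also have "\<dots> = 1 / ((a + c) * (a + b + c))"
  proof -
    have "((a + c) * b) * ((a + b + c) * b) = b\<^sup>2 * ((a + c) * (a + b + c))"
      by (simp add: power2_eq_square)
    moreover have "b\<^sup>2 / (b\<^sup>2 * X) = 1 / X" for X using assms by simp
    ultimately show ?thesis by (simp only:)
  qed
  also have "\<dots> \<le> 1 / ((a * c) powr (1/2) * (a * b * c) powr (1/3))"
    using powr_half_le_add[of a c] powr_third_le_add[of a b c] assms
    by (intro divide_left_mono mult_mono mult_pos_pos add_pos_pos) auto
  also have "\<dots> = a powr (-5/6) * c powr (-5/6) * b powr (-1/3)"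
  proof -
    have "a powr (-5/6) = 1 / (a powr (1/2) * a powr (1/3))" "c powr (-5/6) = 1 / (c powr (1/2) * c powr (1/3))"
      using assms by (simp_all add: powr_minus_divide flip: powr_add)
    then show ?thesis using assms by (simp add: powr_mult powr_minus_divide)
  qed
  also have "\<dots> \<le> a powr (-5/6) * c powr (-5/6) * b powr (-5/6)"
    using assms by (intro mult_left_mono powr_mono') auto
  also have "\<dots> = (a * b * c) powr (-5/6)"
    using assms by (simp add: powr_mult)
  finally have "h\<^sup>2 * (1 / P) \<le> h\<^sup>2 * (1 / Q + (a * b * c) powr (-5/6))"
    by (intro mult_left_mono) auto
  then show ?thesis by (simp add: P_def Q_def algebra_simps power2_eq_square)
qed

text \<open>The absolute value allows gaps to be written without knowing the order of the times. At
  0 the value is 0, by the convention for \<open>powr\<close>.\<close>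

definition sing :: "real \<Rightarrow> ennreal" where
  "sing u = ennreal (\<bar>u\<bar> powr (-5/6))"

lemma borel_measurable_sing [measurable]: "sing \<in> borel_measurable borel"
  unfolding sing_def by measurable

lemma sing_mult3:
  assumes "0 < a" "0 < b" "0 < c"
  shows "ennreal ((a * b * c) powr (-5/6)) = sing a * sing b * sing c"
  using assms by (simp add: sing_def powr_mult ennreal_mult)

section \<open>Exact joint moments for disjoint, interlaced and nested intervals\<close>

context brownian_motion begin

definition half_dim :: real where "half_dim = real CARD('d) / 2"

lemma distr_increment:
  assumes "0 \<le> s" "s < t" "t \<le> 1"
  shows "distr M borel (\<lambda>\<omega>. B t \<omega> - B s \<omega>) = gauss_law (t - s)"
  using distributed_distr_eq_density[OF gaussian_increments[OF assms]]
  unfolding gauss_law_def by (simp cong: distr_cong)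

lemma measurable_increment:
  assumes "s \<in> {0..1}" "t \<in> {0..1}"
  shows "(\<lambda>\<omega>. B t \<omega> - B s \<omega>) \<in> borel_measurable M"
  using measurable_at assms by auto

lemma nn_integral_increment:
  assumes "0 \<le> s" "s < t" "t \<le> 1" "h > 0"
  shows "(\<integral>\<^sup>+ \<omega>. ennreal (bump h (B t \<omega> - B s \<omega>)) \<partial>M) = ennreal ((h / (h + (t - s))) powr half_dim)"
proof -
  have "(\<integral>\<^sup>+ \<omega>. ennreal (bump h (B t \<omega> - B s \<omega>)) \<partial>M) = (\<integral>\<^sup>+ x. ennreal (bump h (x + 0)) \<partial>(gauss_law (t - s) :: (real^'d) measure))"
    unfolding distr_increment[OF assms(1-3), symmetric]
    using measurable_increment[of s t] assms by (subst nn_integral_distr) auto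
  also have "\<dots> = ennreal ((h / (h + (t - s))) powr half_dim)"
    using assms by (subst nn_integral_bump_gauss_law) (auto simp: half_dim_def)
  finally show ?thesis .
qed

lemma emeasure_gauss_law_UNIV:
  assumes "0 \<le> s" "s < t" "t \<le> 1"
  shows "emeasure (gauss_law (t - s) :: (real^'d) measure) UNIV = 1"
proof -
  interpret D: prob_space "distr M borel (\<lambda>\<omega>. B t \<omega> - B s \<omega>)"
    using measurable_increment[of s t] assms by (intro prob_space_distr) auto
  show ?thesis using D.emeasure_space_1 unfolding distr_increment[OF assms] by simp
qed

lemma disjoint_moment:
  assumes "0 \<le> a" "a < b" "b < c" "c < e" "e \<le> 1" "h > 0"
  shows "(\<integral>\<^sup>+ \<omega>. ennreal (bump h (B b \<omega> - B a \<omega>) * bump h (B e \<omega> - B c \<omega>)) \<partial>M)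
     = ennreal ((h / (h + (b - a))) powr half_dim * (h / (h + (e - c))) powr half_dim)"
proof -
  let ?m = "\<lambda>u. (h / (h + u)) powr half_dim"
  have "(\<integral>\<^sup>+ \<omega>. ennreal (bump h (B b \<omega> - B a \<omega>) * bump h (B e \<omega> - B c \<omega>)) \<partial>M)
     = (\<integral>\<^sup>+ y. \<integral>\<^sup>+ z. \<integral>\<^sup>+ x. ennreal (bump h (x + 0)) * ennreal (bump h (z + 0)) \<partial>(gauss_law (b - a) :: (real^'d) measure) \<partial>(gauss_law (e - c) :: (real^'d) measure) \<partial>(gauss_law (c - b) :: (real^'d) measure))"
    using nn_integral_increments3[of a b c e "\<lambda>x y z. ennreal (bump h x * bump h z)"] assms
    by (simp add: ennreal_mult)
  also have "\<dots> = (\<integral>\<^sup>+ y. ennreal (?m (b - a) * ?m (e - c)) \<partial>(gauss_law (c - b) :: (real^'d) measure))"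
    using assms by (subst nn_integral_multc, simp, subst nn_integral_bump_gauss_law, simp, simp,
       subst nn_integral_cmult, simp, subst nn_integral_bump_gauss_law, simp, simp)
       (simp add: half_dim_def ennreal_mult)
  also have "\<dots> = ennreal (?m (b - a) * ?m (e - c))"
    using emeasure_gauss_law_UNIV[of b c] assms by simp
  finally show ?thesis .
qed

text \<open>Smoothing over the two outer increments leaves
  \<open>bump (h + a) y * bump (h + c) y\<close> in the shared increment y. This is a single bump of
  parameter \<kappa> by \<open>bump_mult\<close>, and smoothing over y finishes. The denominator is
  the determinant (h + a + b) * (h + b + c) - b^2.\<close>

lemma interleaved_moment:
  assumes "0 \<le> s" "s < s'" "s' < t" "t < t'" "t' \<le> 1" "h > 0"
  defines "a \<equiv> s' - s" and "b \<equiv> t - s'" and "c \<equiv> t' - t"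
  shows "(\<integral>\<^sup>+ \<omega>. ennreal (bump h (B t \<omega> - B s \<omega>) * bump h (B t' \<omega> - B s' \<omega>)) \<partial>M)
     = ennreal ((h\<^sup>2 / ((h + a) * (h + c) + b * (2 * h + a + c))) powr half_dim)"
proof -
  have pos: "a > 0" "b > 0" "c > 0" using assms by auto
  let ?\<kappa> = "(h + a) * (h + c) / ((h + a) + (h + c))"
  have \<kappa>: "?\<kappa> > 0" using pos \<open>h > 0\<close> by auto
  have "(\<integral>\<^sup>+ \<omega>. ennreal (bump h (B t \<omega> - B s \<omega>) * bump h (B t' \<omega> - B s' \<omega>)) \<partial>M)
     = (\<integral>\<^sup>+ \<omega>. ennreal (bump h ((B s' \<omega> - B s \<omega>) + (B t \<omega> - B s' \<omega>)) * bump h ((B t' \<omega> - B t \<omega>) + (B t \<omega> - B s' \<omega>))) \<partial>M)"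
    by simp
  also have "\<dots> = (\<integral>\<^sup>+ y. \<integral>\<^sup>+ z. \<integral>\<^sup>+ x. ennreal (bump h (x + y)) * ennreal (bump h (z + y)) \<partial>gauss_law a \<partial>gauss_law c \<partial>(gauss_law b :: (real^'d) measure))"
    unfolding a_def b_def c_def
    using nn_integral_increments3[of s s' t t' "\<lambda>x y z. ennreal (bump h (x + y) * bump h (z + y))"] assms
    by (simp add: ennreal_mult)
  also have "\<dots> = (\<integral>\<^sup>+ y. ennreal ((h / (h + a)) powr half_dim * (h / (h + c)) powr half_dim) * ennreal (bump ?\<kappa> (y + 0)) \<partial>(gauss_law b :: (real^'d) measure))"
  proof (rule nn_integral_cong)
    fix y :: "real ^ 'd"
    have "bump (h + a) y * bump (h + c) y = bump ?\<kappa> y"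
      using pos \<open>h > 0\<close> by (intro bump_mult) auto
    then show "(\<integral>\<^sup>+ z. \<integral>\<^sup>+ x. ennreal (bump h (x + y)) * ennreal (bump h (z + y)) \<partial>gauss_law a \<partial>gauss_law c)
       = ennreal ((h / (h + a)) powr half_dim * (h / (h + c)) powr half_dim) * ennreal (bump ?\<kappa> (y + 0))"
      using pos \<open>h > 0\<close>
      by (subst nn_integral_multc, simp, subst nn_integral_bump_gauss_law, simp, simp,
        subst nn_integral_cmult, simp, subst nn_integral_bump_gauss_law, simp, simp)
         (simp add: half_dim_def ac_simps flip: ennreal_mult)
  qed
  also have "\<dots> = ennreal ((h / (h + a)) powr half_dim * (h / (h + c)) powr half_dim * (?\<kappa> / (?\<kappa> + b)) powr half_dim)"
    using pos \<kappa> by (subst nn_integral_cmult, simp, subst nn_integral_bump_gauss_law)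
      (simp_all add: half_dim_def flip: ennreal_mult)
  also have "(h / (h + a)) powr half_dim * (h / (h + c)) powr half_dim * (?\<kappa> / (?\<kappa> + b)) powr half_dim
     = ((h / (h + a)) * (h / (h + c)) * (?\<kappa> / (?\<kappa> + b))) powr half_dim"
    using pos \<kappa> \<open>h > 0\<close> by (intro powr_mult3[symmetric] divide_nonneg_nonneg add_nonneg_nonneg mult_nonneg_nonneg) linarith+
  also have "(h / (h + a)) * (h / (h + c)) * (?\<kappa> / (?\<kappa> + b)) = h\<^sup>2 / ((h + a) * (h + c) + b * (2 * h + a + c))"
  proof -
    have "?\<kappa> / (?\<kappa> + b) = (h + a) * (h + c) / ((h + a) * (h + c) + b * (2 * h + a + c))"
      using pos \<open>h > 0\<close> by (simp add: divide_simps) (simp add: algebra_simps)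
    then show ?thesis using pos \<open>h > 0\<close> by (simp add: power2_eq_square)
  qed
  finally show ?thesis .
qed

text \<open>The outer increments enter only the factor of the longer interval, where smoothing
  raises its parameter to h + a + c; the inner increment y enters both factors. The denominator is
  the determinant (h + a + b + c) * (h + b) - b^2.\<close>

lemma nested_moment:
  assumes "0 \<le> s" "s < s'" "s' < t'" "t' < t" "t \<le> 1" "h > 0"
  defines "a \<equiv> s' - s" and "b \<equiv> t' - s'" and "c \<equiv> t - t'"
  shows "(\<integral>\<^sup>+ \<omega>. ennreal (bump h (B t \<omega> - B s \<omega>) * bump h (B t' \<omega> - B s' \<omega>)) \<partial>M)
     = ennreal ((h\<^sup>2 / ((h + (a + c)) * (h + b) + h * b)) powr half_dim)"
proof -
  have pos: "a > 0" "b > 0" "c > 0" using assms by auto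
  let ?\<kappa> = "(h + a + c) * h / ((h + a + c) + h)"
  have \<kappa>: "?\<kappa> > 0" using pos \<open>h > 0\<close> by auto
  have "(\<integral>\<^sup>+ \<omega>. ennreal (bump h (B t \<omega> - B s \<omega>) * bump h (B t' \<omega> - B s' \<omega>)) \<partial>M)
     = (\<integral>\<^sup>+ \<omega>. ennreal (bump h ((B s' \<omega> - B s \<omega>) + ((B t \<omega> - B t' \<omega>) + (B t' \<omega> - B s' \<omega>))) * bump h (B t' \<omega> - B s' \<omega>)) \<partial>M)"
    by simp
  also have "\<dots> = (\<integral>\<^sup>+ y. \<integral>\<^sup>+ z. \<integral>\<^sup>+ x. ennreal (bump h (x + (z + y))) * ennreal (bump h y) \<partial>gauss_law a \<partial>gauss_law c \<partial>(gauss_law b :: (real^'d) measure))"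
    unfolding a_def b_def c_def
    using nn_integral_increments3[of s s' t' t "\<lambda>x y z. ennreal (bump h (x + (z + y)) * bump h y)"] assms
    by (simp add: ennreal_mult)
  also have "\<dots> = (\<integral>\<^sup>+ y. ennreal ((h / (h + a)) powr half_dim * ((h + a) / (h + a + c)) powr half_dim) * ennreal (bump ?\<kappa> (y + 0)) \<partial>(gauss_law b :: (real^'d) measure))"
  proof (rule nn_integral_cong)
    fix y :: "real ^ 'd"
    have "bump (h + a + c) y * bump h y = bump ?\<kappa> y"
      using pos \<open>h > 0\<close> by (intro bump_mult) auto
    moreover have "(\<integral>\<^sup>+ z. \<integral>\<^sup>+ x. ennreal (bump h (x + (z + y))) * ennreal (bump h y) \<partial>gauss_law a \<partial>gauss_law c)
       = (\<integral>\<^sup>+ z. ennreal ((h / (h + a)) powr half_dim) * ennreal (bump h y) * ennreal (bump (h + a) (z + y)) \<partial>gauss_law c)"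
      using pos \<open>h > 0\<close>
      by (intro nn_integral_cong, subst nn_integral_multc, simp, subst nn_integral_bump_gauss_law)
         (simp_all add: half_dim_def ac_simps ennreal_mult)
    moreover have "\<dots> = ennreal ((h / (h + a)) powr half_dim) * ennreal (bump h y) * ennreal (((h + a) / (h + a + c)) powr half_dim * bump (h + a + c) y)"
      using pos \<open>h > 0\<close>
      by (subst nn_integral_cmult, simp, subst nn_integral_bump_gauss_law)
         (simp_all add: half_dim_def)
    ultimately show "(\<integral>\<^sup>+ z. \<integral>\<^sup>+ x. ennreal (bump h (x + (z + y))) * ennreal (bump h y) \<partial>gauss_law a \<partial>gauss_law c)
       = ennreal ((h / (h + a)) powr half_dim * ((h + a) / (h + a + c)) powr half_dim) * ennreal (bump ?\<kappa> (y + 0))"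
      by (simp add: ac_simps flip: ennreal_mult)
  qed
  also have "\<dots> = ennreal ((h / (h + a)) powr half_dim * ((h + a) / (h + a + c)) powr half_dim * (?\<kappa> / (?\<kappa> + b)) powr half_dim)"
    using pos \<kappa> by (subst nn_integral_cmult, simp, subst nn_integral_bump_gauss_law)
      (simp_all add: half_dim_def flip: ennreal_mult)
  also have "(h / (h + a)) powr half_dim * ((h + a) / (h + a + c)) powr half_dim * (?\<kappa> / (?\<kappa> + b)) powr half_dim
     = ((h / (h + a)) * ((h + a) / (h + a + c)) * (?\<kappa> / (?\<kappa> + b))) powr half_dim"
    using pos \<kappa> \<open>h > 0\<close> by (intro powr_mult3[symmetric] divide_nonneg_nonneg add_nonneg_nonneg mult_nonneg_nonneg) linarith+
  also have "(h / (h + a)) * ((h + a) / (h + a + c)) * (?\<kappa> / (?\<kappa> + b)) = h\<^sup>2 / ((h + (a + c)) * (h + b) + h * b)"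
  proof -
    have "?\<kappa> / (?\<kappa> + b) = (h + a + c) * h / ((h + (a + c)) * (h + b) + h * b)"
      using pos \<open>h > 0\<close> by (simp add: divide_simps) (simp add: algebra_simps)
    then show ?thesis using pos \<open>h > 0\<close> by (simp add: power2_eq_square)
  qed
  finally show ?thesis .
qed

text \<open>The exponent 9/8 leaves the bounds integrable for d \<ge> 3 and still makes the variance o(h^2).
  The sum of two \<open>sing\<close> factors replaces the one at the gap between s' and min t t'.\<close>
lemma joint_moment_bound:
  assumes q: "CARD('d) = 2 \<and> q = 1 \<or> CARD('d) \<ge> 3 \<and> q = 9/8"
    and h: "0 < h"
    and st: "0 \<le> s" "s < t" "t \<le> 1" "s' < t'" "t' \<le> 1" "s < s'" "t \<noteq> s'" "t \<noteq> t'"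
  shows "(\<integral>\<^sup>+ \<omega>. ennreal (bump h (B t \<omega> - B s \<omega>) * bump h (B t' \<omega> - B s' \<omega>)) \<partial>M)
     \<le> ennreal ((h / (h + (t - s))) powr half_dim * (h / (h + (t' - s'))) powr half_dim)
       + ennreal (h powr (2 * q)) * (sing (s' - s) * (sing (t - s') + sing (t' - s')) * sing (t - t'))"
proof -
  have hd: "q \<le> half_dim" "0 < q" "q \<le> 5/4" using q by (auto simp: half_dim_def)
  have sym: "sing (t' - t) = sing (t - t')" by (simp add: sing_def abs_minus_commute)
  consider "t < s'" | "s' < t" "t < t'" | "s' < t" "t' < t" using st by linarith
  then show ?thesis
  proof cases
    case 1
    then show ?thesis using disjoint_moment[of s t s' t' h] st h by simp
  next
    case 2
    have "(\<integral>\<^sup>+ \<omega>. ennreal (bump h (B t \<omega> - B s \<omega>) * bump h (B t' \<omega> - B s' \<omega>)) \<partial>M)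
       \<le> ennreal (h powr (2 * q) * ((s' - s) * (t - s') * (t' - t)) powr (-5/6))"
      using 2 st h hd by (simp only: interleaved_moment) (intro ennreal_leI interleaved_bound, simp_all)
    also have "\<dots> = ennreal (h powr (2 * q)) * (sing (s' - s) * sing (t - s') * sing (t - t'))"
      using 2 st by (subst ennreal_mult, simp, simp, subst sing_mult3) (simp_all add: sym)
    also have "\<dots> \<le> ennreal (h powr (2 * q)) * (sing (s' - s) * (sing (t - s') + sing (t' - s')) * sing (t - t'))"
      by (intro mult_mono) auto
    finally show ?thesis by (simp add: add_increasing)
  next
    case 3
    have "(\<integral>\<^sup>+ \<omega>. ennreal (bump h (B t \<omega> - B s \<omega>) * bump h (B t' \<omega> - B s' \<omega>)) \<partial>M)
       \<le> ennreal ((h / (h + (t - s))) powr half_dim * (h / (h + (t' - s'))) powr half_dim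
          + h powr (2 * q) * ((s' - s) * (t' - s') * (t - t')) powr (-5/6))"
    proof -
      have "(\<integral>\<^sup>+ \<omega>. ennreal (bump h (B t \<omega> - B s \<omega>) * bump h (B t' \<omega> - B s' \<omega>)) \<partial>M)
        = ennreal ((h\<^sup>2 / ((h + (s' - s + (t - t'))) * (h + (t' - s')) + h * (t' - s'))) powr half_dim)"
        using st h 3(2) by (intro nested_moment) simp_all
      also have "ennreal ((h\<^sup>2 / ((h + (s' - s + (t - t'))) * (h + (t' - s')) + h * (t' - s'))) powr half_dim)
        \<le> ennreal ((h / (h + (t - s))) powr half_dim * (h / (h + (t' - s'))) powr half_dim
          + h powr (2 * q) * ((s' - s) * (t' - s') * (t - t')) powr (-5/6))"
      \<comment> \<open>For d = 2 the product of the means is an essential part of the bound. For d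
        \<ge> 3 it is merely added as a nonnegative term.\<close>
      proof (cases "CARD('d) = 2")
        case True
        then have "half_dim = 1" "q = 1" using q by (auto simp: half_dim_def)
        moreover have "(h + (s' - s + (t - t'))) * (h + (t' - s')) + h * (t' - s') > 0"
          using 3 st h by (intro add_pos_pos mult_pos_pos) auto
        moreover have "s' - s + (t' - s') + (t - t') = t - s" by simp
        moreover have "h\<^sup>2 / ((h + (s' - s + (t - t'))) * (h + (t' - s')) + h * (t' - s'))
          \<le> (h / (h + (s' - s + (t' - s') + (t - t')))) * (h / (h + (t' - s')))
            + h\<^sup>2 * ((s' - s) * (t' - s') * (t - t')) powr (-5/6)"
          using 3 st h by (intro nested_bound_2) simp_all
        moreover have "h powr (2 * 1) = h\<^sup>2" using h by (simp add: powr_numeral)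
        moreover have "0 \<le> h / (h + (t - s))" "0 \<le> h / (h + (t' - s'))"
          using h st by simp_all
        moreover have "0 < h\<^sup>2 / ((h + (s' - s + (t - t'))) * (h + (t' - s')) + h * (t' - s'))"
          by (intro divide_pos_pos calculation) (use h in simp)
        ultimately show ?thesis
          by (intro ennreal_leI) (simp only: powr_one)
      next
        case False
        then have "2 * q = 9/4" "3/2 \<le> half_dim" using q by (auto simp: half_dim_def)
        then show ?thesis
          using nested_bound_ge3[of "s' - s" "t' - s'" "t - t'" h half_dim] 3 st h unfolding \<open>2 * q = 9/4\<close> by (intro ennreal_leI add_increasing mult_nonneg_nonneg) simp_all
      qed
      finally show ?thesis .
    qed
    also have "\<dots> = ennreal ((h / (h + (t - s))) powr half_dim * (h / (h + (t' - s'))) powr half_dim)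
        + ennreal (h powr (2 * q)) * (sing (s' - s) * sing (t' - s') * sing (t - t'))"
    proof -
      have "ennreal (x + y * z) = ennreal x + ennreal y * ennreal z" if "0 \<le> x" "0 \<le> y" "0 \<le> z" for x y z
        using that by (simp add: ennreal_mult)
      moreover have "ennreal (((s' - s) * (t' - s') * (t - t')) powr (-5/6)) = sing (s' - s) * sing (t' - s') * sing (t - t')"
        using 3 st by (intro sing_mult3) simp_all
      ultimately show ?thesis by (metis mult_nonneg_nonneg powr_ge_zero)
    qed
    also have "\<dots> \<le> ennreal ((h / (h + (t - s))) powr half_dim * (h / (h + (t' - s'))) powr half_dim)
        + ennreal (h powr (2 * q)) * (sing (s' - s) * (sing (t - s') + sing (t' - s')) * sing (t - t'))"
      by (intro add_mono mult_mono) auto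
    finally show ?thesis .
  qed
qed

end

section \<open>Time averages and a jointly measurable version\<close>

text \<open>The uniform law on the unit interval, carried by all of \<open>real\<close> so that
  measurability stays plain Borel measurability; being a probability measure, it makes bounded
  integrands integrable.\<close>

definition unit_law :: "real measure" where
  "unit_law = density lborel (indicator {0..1})"

lemma sets_unit_law [simp, measurable_cong]: "sets unit_law = sets borel"
  by (simp add: unit_law_def)

lemma space_unit_law [simp]: "space unit_law = UNIV"
  by (simp add: unit_law_def)

interpretation unit_law: prob_space unit_law
  by standard (simp add: unit_law_def emeasure_density)

interpretation unit_pair: pair_prob_space unit_law unit_law ..

lemma AE_unit_law: "(AE t in unit_law. P t) \<longleftrightarrow> (AE t in lborel. t \<in> {0..1} \<longrightarrow> P t)"
  unfolding unit_law_def by (subst AE_density) (auto simp: indicator_def)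

lemma AE_unit_law_mem: "AE t in unit_law. 0 \<le> t \<and> t \<le> 1"
  by (simp add: AE_unit_law)

lemma AE_unit_law_neq: "AE t in unit_law. t \<noteq> c"
  unfolding AE_unit_law using AE_lborel_singleton[of c] by eventually_elim auto

lemma nn_integral_unit_law_mono:
  assumes "\<And>t. 0 \<le> t \<Longrightarrow> t \<le> 1 \<Longrightarrow> f t \<le> g t"
  shows "(\<integral>\<^sup>+ t. f t \<partial>unit_law) \<le> (\<integral>\<^sup>+ t. g t \<partial>unit_law)"
  using AE_unit_law_mem by (rule nn_integral_mono_AE[OF eventually_mono]) (use assms in auto)

lemma nn_integral_unit_law:
  "f \<in> borel_measurable borel \<Longrightarrow> (\<integral>\<^sup>+ t. f t \<partial>unit_law) = (\<integral>\<^sup>+ t. f t * indicator {0..1} t \<partial>lborel)"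
  unfolding unit_law_def by (subst nn_integral_density) (auto simp: mult.commute)

lemma set_integral_unit_law:
  fixes f :: "real \<Rightarrow> real"
  shows "f \<in> borel_measurable borel \<Longrightarrow> (LINT t:{0..1}|lborel. f t) = (\<integral> t. f t \<partial>unit_law)"
proof -
  assume [measurable]: "f \<in> borel_measurable borel"
  have "unit_law = density lborel (\<lambda>x. ennreal (indicator {0..1} x))"
    by (simp add: unit_law_def ennreal_indicator)
  moreover have "(\<integral> t. f t \<partial>density lborel (\<lambda>x. ennreal (indicator {0..1} x))) = (\<integral> t. indicator {0..1} t *\<^sub>R f t \<partial>lborel)"
    by (rule integral_density) auto
  ultimately show ?thesis by (simp only: set_lebesgue_integral_def)
qed

section \<open>Integrability of the singular kernel over four times\<close>

lemma sing_commute: "sing (u - v) = sing (v - u)"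
  by (simp add: sing_def abs_minus_commute)

lemma nn_integral_sing_unit_interval:
  "(\<integral>\<^sup>+ x. sing x * indicator {0..1} x \<partial>lborel) = 6"
proof -
  have "((\<lambda>x. x powr (-5/6)) has_integral (1 powr (-5/6 + 1) / (-5/6 + 1))) {0..1::real}"
    by (rule has_integral_powr_from_0) auto
  then have "((\<lambda>x. if x \<in> {0..1} then x powr (-5/6) else 0) has_integral (6::real)) UNIV"
    by (subst has_integral_restrict_UNIV) simp
  then have "(\<integral>\<^sup>+ x. ennreal (if x \<in> {0..1} then x powr (-5/6) else 0) \<partial>lborel) = ennreal 6"
    by (rule nn_integral_has_integral_lborel[rotated 2]) auto
  moreover have "(\<integral>\<^sup>+ x. sing x * indicator {0..1} x \<partial>lborel) = (\<integral>\<^sup>+ x. ennreal (if x \<in> {0..1} then x powr (-5/6) else 0) \<partial>lborel)"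
    by (intro nn_integral_cong) (auto simp: sing_def indicator_def)
  ultimately show ?thesis by simp
qed

text \<open>After translation by v the domain lies between -1 and 1, and each half contributes at
  most 6. What matters is that the bound is uniform in v.\<close>

lemma nn_integral_sing_le:
  assumes "v \<in> {0..1}"
  shows "(\<integral>\<^sup>+ u. sing (u - v) \<partial>unit_law) \<le> 12"
proof -
  have "(\<integral>\<^sup>+ u. sing (u - v) \<partial>unit_law) = (\<integral>\<^sup>+ x. sing x * indicator {0..1} (v + x) \<partial>lborel)"
    by (subst nn_integral_unit_law, simp, subst nn_integral_real_affine[of _ 1 v]) auto
  also have "\<dots> \<le> (\<integral>\<^sup>+ x. sing x * indicator {0..1} x + sing x * indicator {0..1} (- x) \<partial>lborel)"
    using assms by (intro nn_integral_mono) (auto simp: indicator_def)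
  also have "\<dots> = 6 + (\<integral>\<^sup>+ x. sing x * indicator {0..1} (- x) \<partial>lborel)"
    by (subst nn_integral_add) (auto simp: nn_integral_sing_unit_interval)
  also have "(\<integral>\<^sup>+ x. sing x * indicator {0..1} (- x) \<partial>lborel) = (\<integral>\<^sup>+ x. sing x * indicator {0..1} x \<partial>lborel)"
    by (subst nn_integral_real_affine[of _ "-1" 0]) (auto simp: sing_def)
  finally show ?thesis by (simp add: nn_integral_sing_unit_interval)
qed

text \<open>The singular factor of \<open>joint_moment_bound\<close> for x = (s, t) and y = (s',
  t'). It is not symmetric: x plays the interval that starts first.\<close>

definition kern :: "real \<times> real \<Rightarrow> real \<times> real \<Rightarrow> ennreal" where
  "kern x y = sing (fst y - fst x) * (sing (snd x - fst y) + sing (snd y - fst y)) * sing (snd x - snd y)"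

lemma measurable_kern [measurable (raw)]:
  assumes [measurable]: "f \<in> measurable N (borel \<Otimes>\<^sub>M borel)" "g \<in> measurable N (borel \<Otimes>\<^sub>M borel)"
  shows "(\<lambda>w. kern (f w) (g w)) \<in> borel_measurable N"
  unfolding kern_def by measurable

text \<open>In each of the two terms the gaps link the four times in a chain, s, s', t, t' or s, s',
  t', t. Integrating from the free end costs 12 per link, so each term is at most 12^3 and the total
  is 2 * 12^3 = 3456. Exchanging t and t' turns the second chain into the first.\<close>

lemma nn_integral_kern_le:
  "(\<integral>\<^sup>+ x. \<integral>\<^sup>+ y. kern x y \<partial>(unit_law \<Otimes>\<^sub>M unit_law) \<partial>(unit_law \<Otimes>\<^sub>M unit_law)) \<le> 3456"
proof -
  have inner: "(\<integral>\<^sup>+ t. \<integral>\<^sup>+ t'. (sing (t - s') + sing (t' - s')) * sing (t - t') \<partial>unit_law \<partial>unit_law) \<le> 288"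
    if s': "s' \<in> {0..1}" for s'
  proof -
    have "(\<integral>\<^sup>+ t. \<integral>\<^sup>+ t'. (sing (t - s') + sing (t' - s')) * sing (t - t') \<partial>unit_law \<partial>unit_law)
      = (\<integral>\<^sup>+ t. (\<integral>\<^sup>+ t'. sing (t - s') * sing (t - t') \<partial>unit_law) + (\<integral>\<^sup>+ t'. sing (t' - s') * sing (t - t') \<partial>unit_law) \<partial>unit_law)"
      by (intro nn_integral_cong) (simp add: distrib_right nn_integral_add)
    also have "\<dots> = (\<integral>\<^sup>+ t. \<integral>\<^sup>+ t'. sing (t - s') * sing (t - t') \<partial>unit_law \<partial>unit_law)
        + (\<integral>\<^sup>+ t. \<integral>\<^sup>+ t'. sing (t' - s') * sing (t - t') \<partial>unit_law \<partial>unit_law)"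
      by (rule nn_integral_add) measurable
    also have "(\<integral>\<^sup>+ t. \<integral>\<^sup>+ t'. sing (t' - s') * sing (t - t') \<partial>unit_law \<partial>unit_law)
       = (\<integral>\<^sup>+ t. \<integral>\<^sup>+ t'. sing (t - s') * sing (t - t') \<partial>unit_law \<partial>unit_law)"
      by (subst unit_pair.Fubini') (auto simp: sing_commute intro!: nn_integral_cong)
    also have "(\<integral>\<^sup>+ t. \<integral>\<^sup>+ t'. sing (t - s') * sing (t - t') \<partial>unit_law \<partial>unit_law) \<le> (\<integral>\<^sup>+ t. sing (t - s') * 12 \<partial>unit_law)"
    proof (rule nn_integral_unit_law_mono)
      fix t :: real assume t: "0 \<le> t" "t \<le> 1"
      have "(\<integral>\<^sup>+ t'. sing (t - s') * sing (t - t') \<partial>unit_law) = sing (t - s') * (\<integral>\<^sup>+ t'. sing (t' - t) \<partial>unit_law)"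
        by (subst nn_integral_cmult) (auto simp: sing_commute)
      also have "\<dots> \<le> sing (t - s') * 12"
        using t by (intro mult_left_mono nn_integral_sing_le) auto
      finally show "(\<integral>\<^sup>+ t'. sing (t - s') * sing (t - t') \<partial>unit_law) \<le> sing (t - s') * 12" .
    qed
    also have "\<dots> \<le> 12 * 12"
      using s' by (subst nn_integral_multc, simp) (intro mult_right_mono nn_integral_sing_le, simp_all)
    finally show ?thesis by (simp add: add_mono)
  qed
  have "(\<integral>\<^sup>+ x. \<integral>\<^sup>+ y. kern x y \<partial>(unit_law \<Otimes>\<^sub>M unit_law) \<partial>(unit_law \<Otimes>\<^sub>M unit_law))
     = (\<integral>\<^sup>+ s. \<integral>\<^sup>+ t. \<integral>\<^sup>+ s'. \<integral>\<^sup>+ t'. kern (s, t) (s', t') \<partial>unit_law \<partial>unit_law \<partial>unit_law \<partial>unit_law)"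
    by (simp add: unit_law.nn_integral_fst[symmetric])
  also have "\<dots> = (\<integral>\<^sup>+ s. \<integral>\<^sup>+ s'. \<integral>\<^sup>+ t. \<integral>\<^sup>+ t'. kern (s, t) (s', t') \<partial>unit_law \<partial>unit_law \<partial>unit_law \<partial>unit_law)"
    by (intro nn_integral_cong unit_pair.Fubini') simp
  also have "\<dots> = (\<integral>\<^sup>+ s. \<integral>\<^sup>+ s'. sing (s' - s) * (\<integral>\<^sup>+ t. \<integral>\<^sup>+ t'. (sing (t - s') + sing (t' - s')) * sing (t - t') \<partial>unit_law \<partial>unit_law) \<partial>unit_law \<partial>unit_law)"
    unfolding kern_def by (simp add: mult.assoc nn_integral_cmult)
  also have "\<dots> \<le> (\<integral>\<^sup>+ s. \<integral>\<^sup>+ s'. sing (s' - s) * 288 \<partial>unit_law \<partial>unit_law)"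
    by (intro nn_integral_unit_law_mono mult_left_mono inner) auto
  also have "\<dots> \<le> (\<integral>\<^sup>+ s. 12 * 288 \<partial>unit_law)"
  proof (rule nn_integral_unit_law_mono)
    fix s :: real assume "0 \<le> s" "s \<le> 1"
    then show "(\<integral>\<^sup>+ s'. sing (s' - s) * 288 \<partial>unit_law) \<le> 12 * 288"
      by (subst nn_integral_multc, simp) (intro mult_right_mono nn_integral_sing_le, simp_all)
  qed
  finally show ?thesis by (simp add: unit_law.emeasure_space_1[simplified])
qed

section \<open>A version of the process with jointly measurable paths\<close>

context brownian_motion begin

text \<open>The locale gives no joint measurability in time and sample point, and the paths with a
  discontinuity need not form a measurable set.\<close>
lemma exists_jointly_measurable:
  "\<exists>W. (\<lambda>x. W (fst x) (snd x)) \<in> borel_measurable (borel \<Otimes>\<^sub>M M)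
     \<and> (AE \<omega> in M. \<forall>t\<in>{0..1}. W t \<omega> = B t \<omega>)"
proof -
  from continuous_paths obtain N where N: "N \<in> null_sets M" "{\<omega>\<in>space M. \<not> continuous_on {0..1} (\<lambda>t. B t \<omega>)} \<subseteq> N"
    by (auto elim!: AE_E intro: null_setsI)
  then have [measurable]: "N \<in> sets M" by auto
  \<comment> \<open>Clamping the time extends each path continuously to the whole line, where B
    itself is arbitrary.\<close>
  define cl where "cl = (\<lambda>t::real. max 0 (min 1 t))"
  have cl: "cl t \<in> {0..1}" for t by (simp add: cl_def)
  define W where "W = (\<lambda>t \<omega>. if \<omega> \<in> N then 0 else B (cl t) \<omega>)"
  have [measurable]: "W t \<in> borel_measurable M" for t
    using measurable_at[OF cl[of t]] by (simp add: W_def)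
  have cont: "continuous_on UNIV (\<lambda>t. W t \<omega>)" if "\<omega> \<in> space M" for \<omega>
  proof (cases "\<omega> \<in> N")
    case False
    then have "continuous_on {0..1} (\<lambda>t. B t \<omega>)" using N(2) that by auto
    then have "continuous_on UNIV (\<lambda>t. B (cl t) \<omega>)"
      by (rule continuous_on_compose2) (use cl in \<open>auto simp: cl_def intro!: continuous_intros\<close>)
    with False show ?thesis by (simp add: W_def)
  qed (simp add: W_def)
  \<comment> \<open>Freezing time on the grid of mesh 1 / n involves only countably many values of
    the time, so measurability at fixed times is enough for \<open>Wn n\<close>; continuity of the
    paths then gives W as the pointwise limit.\<close>
  define Wn where "Wn = (\<lambda>(n::nat) x. W (of_int \<lfloor>real n * fst x\<rfloor> / real n) (snd x))"
  have m: "Wn n \<in> borel_measurable (borel \<Otimes>\<^sub>M M)" for n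
    unfolding Wn_def
    by (rule measurable_compose_countable[where f = "\<lambda>i x. W (of_int i / real n) (snd x)" and g = "\<lambda>x. \<lfloor>real n * fst x\<rfloor>"]) measurable
  have lim: "(\<lambda>n. Wn n x) \<longlonglongrightarrow> W (fst x) (snd x)" if "x \<in> space (borel \<Otimes>\<^sub>M M)" for x
  proof -
    have "(\<lambda>n. of_int \<lfloor>real n * fst x\<rfloor> / real n) \<longlonglongrightarrow> fst x"
    proof (rule real_tendsto_sandwich)
      show "\<forall>\<^sub>F n in sequentially. (real n * fst x - 1) / real n \<le> of_int \<lfloor>real n * fst x\<rfloor> / real n"
        by (intro always_eventually allI divide_right_mono) linarith+
      show "\<forall>\<^sub>F n in sequentially. of_int \<lfloor>real n * fst x\<rfloor> / real n \<le> (real n * fst x) / real n"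
        by (intro always_eventually allI divide_right_mono) linarith+
      show "(\<lambda>n. (real n * fst x - 1) / real n) \<longlonglongrightarrow> fst x" by real_asymp
      show "(\<lambda>n. (real n * fst x) / real n) \<longlonglongrightarrow> fst x" by real_asymp
    qed
    moreover have "snd x \<in> space M"
      using that by (simp add: space_pair_measure mem_Times_iff)
    then have "isCont (\<lambda>t. W t (snd x)) (fst x)"
      using cont by (simp add: continuous_on_eq_continuous_at)
    ultimately show ?thesis
      unfolding Wn_def by (rule isCont_tendsto_compose[rotated])
  qed
  have "(\<lambda>x. W (fst x) (snd x)) \<in> borel_measurable (borel \<Otimes>\<^sub>M M)"
    by (rule borel_measurable_LIMSEQ_metric[OF m lim])
  moreover have "AE \<omega> in M. \<forall>t\<in>{0..1}. W t \<omega> = B t \<omega>"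
    using AE_not_in[OF N(1)] by eventually_elim (auto simp: W_def cl_def)
  ultimately show ?thesis by blast
qed

end

section \<open>Second moment of the self-overlap\<close>

abbreviation unit_square :: "(real \<times> real) measure" where
  "unit_square \<equiv> unit_law \<Otimes>\<^sub>M unit_law"

text \<open>Coincidences among the four times are negligible. With a and b the endpoints of one
  interval, this supplies the strict separation that the moment bounds require of the other.\<close>

lemma AE_unit_square:
  "AE x in unit_square. 0 \<le> fst x \<and> fst x \<le> 1 \<and> 0 \<le> snd x \<and> snd x \<le> 1
     \<and> fst x \<noteq> a \<and> fst x \<noteq> b \<and> snd x \<noteq> a \<and> snd x \<noteq> b"
proof (rule unit_pair.AE_pair_measure)
  have *: "AE t in unit_law. 0 \<le> t \<and> t \<le> 1 \<and> t \<noteq> a \<and> t \<noteq> b"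
    using AE_unit_law_mem AE_unit_law_neq[of a] AE_unit_law_neq[of b] by eventually_elim auto
  show "AE s in unit_law. AE t in unit_law. 0 \<le> fst (s, t) \<and> fst (s, t) \<le> 1 \<and> 0 \<le> snd (s, t) \<and> snd (s, t) \<le> 1
     \<and> fst (s, t) \<noteq> a \<and> fst (s, t) \<noteq> b \<and> snd (s, t) \<noteq> a \<and> snd (s, t) \<noteq> b"
    using *
  proof eventually_elim
    case (elim s)
    show ?case using * by eventually_elim (use elim in auto)
  qed
qed measurable

text \<open>Restricting to s < t gives each pair of times an interval of positive length, as the
  moment formulas expect; the opposite order is recovered by symmetry. Values in
  \<open>ennreal\<close> permit exchanging integrals without integrability conditions.\<close>

definition ordered_bump :: "(real \<Rightarrow> 'w \<Rightarrow> real ^ 'd) \<Rightarrow> real \<Rightarrow> real \<times> real \<Rightarrow> 'w \<Rightarrow> ennreal" where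
  "ordered_bump W h x \<omega> = (if fst x < snd x then ennreal (bump h (W (snd x) \<omega> - W (fst x) \<omega>)) else 0)"

definition half_overlap :: "(real \<Rightarrow> 'w \<Rightarrow> real ^ 'd) \<Rightarrow> real \<Rightarrow> 'w \<Rightarrow> ennreal" where
  "half_overlap W h \<omega> = (\<integral>\<^sup>+ x. ordered_bump W h x \<omega> \<partial>unit_square)"

text \<open>For p = d / 2 this is the expectation of \<open>ordered_bump\<close>. Keeping p a free
  real separates the calculus of the means from the process.\<close>

definition mean_kern :: "real \<Rightarrow> real \<Rightarrow> real \<times> real \<Rightarrow> ennreal" where
  "mean_kern p h x = (if fst x < snd x then ennreal ((h / (h + (snd x - fst x))) powr p) else 0)"

definition half_mean :: "real \<Rightarrow> real \<Rightarrow> ennreal" where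
  "half_mean p h = (\<integral>\<^sup>+ x. mean_kern p h x \<partial>unit_square)"

lemma measurable_mean_kern [measurable]: "mean_kern p h \<in> borel_measurable (borel \<Otimes>\<^sub>M borel)"
  unfolding mean_kern_def by measurable

lemma half_overlap_le_1: "h > 0 \<Longrightarrow> half_overlap W h \<omega> \<le> 1"
proof -
  assume h: "h > 0"
  have "half_overlap W h \<omega> \<le> (\<integral>\<^sup>+ x. 1 \<partial>unit_square)"
    unfolding half_overlap_def ordered_bump_def
    using bump_le_1[OF h] by (intro nn_integral_mono) auto
  then show ?thesis by (simp add: unit_pair.emeasure_space_1)
qed

text \<open>B keeps the distributional hypotheses, W supplies the joint measurability for Fubini.
  The exceptional null set in \<open>version\<close> serves all times at once, so it also serves all
  \<sigma> at once.\<close>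

locale measurable_version = brownian_motion M B
  for M :: "'w measure" and B :: "real \<Rightarrow> 'w \<Rightarrow> real ^ 'd" +
  fixes W :: "real \<Rightarrow> 'w \<Rightarrow> real ^ 'd"
  assumes jointly: "(\<lambda>x. W (fst x) (snd x)) \<in> borel_measurable (borel \<Otimes>\<^sub>M M)"
    and version: "AE \<omega> in M. \<forall>t\<in>{0..1}. W t \<omega> = B t \<omega>"
begin

lemma measurable_W [measurable (raw)]:
  assumes "f \<in> borel_measurable N" "g \<in> measurable N M"
  shows "(\<lambda>x. W (f x) (g x)) \<in> borel_measurable N"
  using measurable_compose[OF measurable_Pair[OF assms] jointly] by simp

lemma measurable_ordered_bump [measurable (raw)]:
  assumes [measurable]: "f \<in> measurable N (borel \<Otimes>\<^sub>M borel)" "g \<in> measurable N M"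
  shows "(\<lambda>z. ordered_bump W h (f z) (g z)) \<in> borel_measurable N"
  unfolding ordered_bump_def by measurable

lemma measurable_half_overlap [measurable]: "half_overlap W h \<in> borel_measurable M"
  unfolding half_overlap_def by measurable

lemma nn_integral_ordered_bump:
  assumes "h > 0" "fst x \<in> {0..1}" "snd x \<in> {0..1}"
  shows "(\<integral>\<^sup>+ \<omega>. ordered_bump W h x \<omega> \<partial>M) = mean_kern half_dim h x"
proof (cases "fst x < snd x")
  case True
  have "(\<integral>\<^sup>+ \<omega>. ordered_bump W h x \<omega> \<partial>M) = (\<integral>\<^sup>+ \<omega>. ennreal (bump h (B (snd x) \<omega> - B (fst x) \<omega>)) \<partial>M)"
  proof (rule nn_integral_cong_AE)
    show "AE \<omega> in M. ordered_bump W h x \<omega> = ennreal (bump h (B (snd x) \<omega> - B (fst x) \<omega>))"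
      using version by eventually_elim (use True assms in \<open>simp add: ordered_bump_def\<close>)
  qed
  also have "\<dots> = mean_kern half_dim h x"
    using True assms by (subst nn_integral_increment) (auto simp: mean_kern_def)
  finally show ?thesis .
qed (simp add: ordered_bump_def mean_kern_def)

interpretation time_space: pair_sigma_finite unit_square M ..

lemma nn_integral_half_overlap:
  assumes "h > 0"
  shows "(\<integral>\<^sup>+ \<omega>. half_overlap W h \<omega> \<partial>M) = half_mean half_dim h"
proof -
  have "(\<integral>\<^sup>+ \<omega>. half_overlap W h \<omega> \<partial>M) = (\<integral>\<^sup>+ x. \<integral>\<^sup>+ \<omega>. ordered_bump W h x \<omega> \<partial>M \<partial>unit_square)"
    unfolding half_overlap_def by (rule time_space.Fubini') measurable
  also have "\<dots> = half_mean half_dim h"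
    unfolding half_mean_def
  proof (rule nn_integral_cong_AE)
    show "AE x in unit_square. (\<integral>\<^sup>+ \<omega>. ordered_bump W h x \<omega> \<partial>M) = mean_kern half_dim h x"
      using AE_unit_square[of 0 0] by eventually_elim (simp add: nn_integral_ordered_bump assms)
  qed
  finally show ?thesis .
qed

text \<open>\<open>joint_moment_bound\<close> presupposes which interval starts first; adding
  \<open>kern\<close> in both orders removes that restriction. Pairs with the wrong order of
  endpoints contribute 0.\<close>

lemma ordered_bump_joint_bound:
  assumes q: "CARD('d) = 2 \<and> q = 1 \<or> CARD('d) \<ge> 3 \<and> q = 9/8" and h: "0 < h"
    and x: "fst x \<in> {0..1}" "snd x \<in> {0..1}" and y: "fst y \<in> {0..1}" "snd y \<in> {0..1}"
    and neq: "fst y \<noteq> fst x" "fst y \<noteq> snd x" "snd y \<noteq> fst x" "snd y \<noteq> snd x"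
  shows "(\<integral>\<^sup>+ \<omega>. ordered_bump W h x \<omega> * ordered_bump W h y \<omega> \<partial>M)
      \<le> mean_kern half_dim h x * mean_kern half_dim h y + ennreal (h powr (2 * q)) * (kern x y + kern y x)"
proof -
  have main: "(\<integral>\<^sup>+ \<omega>. ordered_bump W h x \<omega> * ordered_bump W h y \<omega> \<partial>M)
      \<le> mean_kern half_dim h x * mean_kern half_dim h y + ennreal (h powr (2 * q)) * kern x y"
    if x: "fst x \<in> {0..1}" "snd x \<in> {0..1}" and y: "fst y \<in> {0..1}" "snd y \<in> {0..1}"
    and neq: "fst y \<noteq> snd x" "snd y \<noteq> snd x" and lt: "fst x < fst y" for x y
  proof (cases "fst x < snd x \<and> fst y < snd y")
    case True
    have "(\<integral>\<^sup>+ \<omega>. ordered_bump W h x \<omega> * ordered_bump W h y \<omega> \<partial>M)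
       = (\<integral>\<^sup>+ \<omega>. ennreal (bump h (B (snd x) \<omega> - B (fst x) \<omega>) * bump h (B (snd y) \<omega> - B (fst y) \<omega>)) \<partial>M)"
    proof (rule nn_integral_cong_AE)
      show "AE \<omega> in M. ordered_bump W h x \<omega> * ordered_bump W h y \<omega>
          = ennreal (bump h (B (snd x) \<omega> - B (fst x) \<omega>) * bump h (B (snd y) \<omega> - B (fst y) \<omega>))"
        using version by eventually_elim (use True x y in \<open>simp add: ordered_bump_def ennreal_mult\<close>)
    qed
    also have "\<dots> \<le> ennreal ((h / (h + (snd x - fst x))) powr half_dim * (h / (h + (snd y - fst y))) powr half_dim)
       + ennreal (h powr (2 * q)) * kern x y"
      unfolding kern_def using True x y neq lt by (intro joint_moment_bound q h) auto
    finally show ?thesis using True by (simp add: mean_kern_def ennreal_mult)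
  next
    case False
    then show ?thesis by (auto simp: ordered_bump_def)
  qed
  consider "fst x < fst y" | "fst y < fst x" using neq by linarith
  then show ?thesis
  proof cases
    case 1
    have "(\<integral>\<^sup>+ \<omega>. ordered_bump W h x \<omega> * ordered_bump W h y \<omega> \<partial>M)
      \<le> mean_kern half_dim h x * mean_kern half_dim h y + ennreal (h powr (2 * q)) * kern x y"
      by (rule main[OF x y _ _ 1]) (use neq in auto)
    also have "\<dots> \<le> mean_kern half_dim h x * mean_kern half_dim h y + ennreal (h powr (2 * q)) * (kern x y + kern y x)"
      by (intro add_left_mono mult_left_mono) auto
    finally show ?thesis .
  next
    case 2
    have "(\<integral>\<^sup>+ \<omega>. ordered_bump W h y \<omega> * ordered_bump W h x \<omega> \<partial>M)
      \<le> mean_kern half_dim h y * mean_kern half_dim h x + ennreal (h powr (2 * q)) * kern y x"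
      by (rule main[OF y x _ _ 2]) (use neq in auto)
    also have "\<dots> \<le> mean_kern half_dim h y * mean_kern half_dim h x + ennreal (h powr (2 * q)) * (kern x y + kern y x)"
      by (intro add_left_mono mult_left_mono) auto
    finally show ?thesis by (simp only: mult.commute)
  qed
qed

text \<open>The square is an integral over pairs of intervals. The products of the means integrate
  to exactly the square of the mean, which leaves only the two kernels: 6912 = 2 * 3456.\<close>

lemma nn_integral_half_overlap_sq:
  assumes q: "CARD('d) = 2 \<and> q = 1 \<or> CARD('d) \<ge> 3 \<and> q = 9/8" and h: "0 < h"
  shows "(\<integral>\<^sup>+ \<omega>. half_overlap W h \<omega> * half_overlap W h \<omega> \<partial>M)
      \<le> half_mean half_dim h * half_mean half_dim h + ennreal (h powr (2 * q)) * 6912"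
proof -
  let ?F = "ordered_bump W h" and ?m = "mean_kern half_dim h" and ?H = "ennreal (h powr (2 * q))"
  have "(\<integral>\<^sup>+ \<omega>. half_overlap W h \<omega> * half_overlap W h \<omega> \<partial>M)
     = (\<integral>\<^sup>+ \<omega>. \<integral>\<^sup>+ x. ?F x \<omega> * half_overlap W h \<omega> \<partial>unit_square \<partial>M)"
    by (intro nn_integral_cong) (simp add: half_overlap_def nn_integral_multc)
  also have "\<dots> = (\<integral>\<^sup>+ x. \<integral>\<^sup>+ \<omega>. ?F x \<omega> * half_overlap W h \<omega> \<partial>M \<partial>unit_square)"
    by (rule time_space.Fubini') measurable
  also have "\<dots> = (\<integral>\<^sup>+ x. \<integral>\<^sup>+ \<omega>. \<integral>\<^sup>+ y. ?F x \<omega> * ?F y \<omega> \<partial>unit_square \<partial>M \<partial>unit_square)"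
    by (intro nn_integral_cong) (simp add: half_overlap_def nn_integral_cmult)
  also have "\<dots> = (\<integral>\<^sup>+ x. \<integral>\<^sup>+ y. \<integral>\<^sup>+ \<omega>. ?F x \<omega> * ?F y \<omega> \<partial>M \<partial>unit_square \<partial>unit_square)"
  proof (rule nn_integral_cong)
    fix x :: "real \<times> real"
    have [measurable]: "(\<lambda>z. x) \<in> measurable N (borel \<Otimes>\<^sub>M borel)" for N :: "'z measure"
      by (simp add: space_pair_measure)
    show "(\<integral>\<^sup>+ \<omega>. \<integral>\<^sup>+ y. ?F x \<omega> * ?F y \<omega> \<partial>unit_square \<partial>M) = (\<integral>\<^sup>+ y. \<integral>\<^sup>+ \<omega>. ?F x \<omega> * ?F y \<omega> \<partial>M \<partial>unit_square)"
      by (rule time_space.Fubini') measurable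
  qed
  also have "\<dots> \<le> (\<integral>\<^sup>+ x. \<integral>\<^sup>+ y. ?m x * ?m y + ?H * (kern x y + kern y x) \<partial>unit_square \<partial>unit_square)"
  proof (rule nn_integral_mono_AE)
    show "AE x in unit_square. (\<integral>\<^sup>+ y. \<integral>\<^sup>+ \<omega>. ?F x \<omega> * ?F y \<omega> \<partial>M \<partial>unit_square)
       \<le> (\<integral>\<^sup>+ y. ?m x * ?m y + ?H * (kern x y + kern y x) \<partial>unit_square)"
      using AE_unit_square[of 0 0]
    proof eventually_elim
      case (elim x)
      show ?case
      proof (rule nn_integral_mono_AE)
        show "AE y in unit_square. (\<integral>\<^sup>+ \<omega>. ?F x \<omega> * ?F y \<omega> \<partial>M) \<le> ?m x * ?m y + ?H * (kern x y + kern y x)"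
          using AE_unit_square[of "fst x" "snd x"]
          by eventually_elim (intro ordered_bump_joint_bound[OF q h], use elim in auto)
      qed
    qed
  qed
  also have "\<dots> = (\<integral>\<^sup>+ x. (\<integral>\<^sup>+ y. ?m x * ?m y \<partial>unit_square)
      + ?H * ((\<integral>\<^sup>+ y. kern x y \<partial>unit_square) + (\<integral>\<^sup>+ y. kern y x \<partial>unit_square)) \<partial>unit_square)"
  proof (rule nn_integral_cong)
    fix x :: "real \<times> real"
    have [measurable]: "(\<lambda>z. x) \<in> measurable N (borel \<Otimes>\<^sub>M borel)" for N :: "'z measure"
      by (simp add: space_pair_measure)
    have "(\<integral>\<^sup>+ y. ?m x * ?m y + ?H * (kern x y + kern y x) \<partial>unit_square)
       = (\<integral>\<^sup>+ y. ?m x * ?m y \<partial>unit_square) + (\<integral>\<^sup>+ y. ?H * (kern x y + kern y x) \<partial>unit_square)"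
      by (rule nn_integral_add) measurable
    also have "(\<integral>\<^sup>+ y. ?H * (kern x y + kern y x) \<partial>unit_square) = ?H * (\<integral>\<^sup>+ y. kern x y + kern y x \<partial>unit_square)"
      by (rule nn_integral_cmult) measurable
    also have "(\<integral>\<^sup>+ y. kern x y + kern y x \<partial>unit_square) = (\<integral>\<^sup>+ y. kern x y \<partial>unit_square) + (\<integral>\<^sup>+ y. kern y x \<partial>unit_square)"
      by (rule nn_integral_add) measurable
    finally show "(\<integral>\<^sup>+ y. ?m x * ?m y + ?H * (kern x y + kern y x) \<partial>unit_square)
       = (\<integral>\<^sup>+ y. ?m x * ?m y \<partial>unit_square) + ?H * ((\<integral>\<^sup>+ y. kern x y \<partial>unit_square) + (\<integral>\<^sup>+ y. kern y x \<partial>unit_square))" .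
  qed
  also have "\<dots> = (\<integral>\<^sup>+ x. \<integral>\<^sup>+ y. ?m x * ?m y \<partial>unit_square \<partial>unit_square)
      + (\<integral>\<^sup>+ x. ?H * ((\<integral>\<^sup>+ y. kern x y \<partial>unit_square) + (\<integral>\<^sup>+ y. kern y x \<partial>unit_square)) \<partial>unit_square)"
    by (rule nn_integral_add) measurable
  also have "(\<integral>\<^sup>+ x. ?H * ((\<integral>\<^sup>+ y. kern x y \<partial>unit_square) + (\<integral>\<^sup>+ y. kern y x \<partial>unit_square)) \<partial>unit_square)
      = ?H * (\<integral>\<^sup>+ x. (\<integral>\<^sup>+ y. kern x y \<partial>unit_square) + (\<integral>\<^sup>+ y. kern y x \<partial>unit_square) \<partial>unit_square)"
    by (rule nn_integral_cmult) measurable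
  also have "(\<integral>\<^sup>+ x. (\<integral>\<^sup>+ y. kern x y \<partial>unit_square) + (\<integral>\<^sup>+ y. kern y x \<partial>unit_square) \<partial>unit_square)
      = (\<integral>\<^sup>+ x. \<integral>\<^sup>+ y. kern x y \<partial>unit_square \<partial>unit_square) + (\<integral>\<^sup>+ x. \<integral>\<^sup>+ y. kern y x \<partial>unit_square \<partial>unit_square)"
    by (rule nn_integral_add) measurable
  also have "(\<integral>\<^sup>+ x. \<integral>\<^sup>+ y. ?m x * ?m y \<partial>unit_square \<partial>unit_square) = half_mean half_dim h * half_mean half_dim h"
    by (simp add: half_mean_def nn_integral_cmult nn_integral_multc)
  also have "(\<integral>\<^sup>+ x. \<integral>\<^sup>+ y. kern y x \<partial>unit_square \<partial>unit_square) = (\<integral>\<^sup>+ x. \<integral>\<^sup>+ y. kern x y \<partial>unit_square \<partial>unit_square)"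
  proof -
    interpret pair_sigma_finite unit_square unit_square ..
    show ?thesis by (rule Fubini') measurable
  qed
  also have "half_mean half_dim h * half_mean half_dim h + ?H * ((\<integral>\<^sup>+ x. \<integral>\<^sup>+ y. kern x y \<partial>unit_square \<partial>unit_square) + (\<integral>\<^sup>+ x. \<integral>\<^sup>+ y. kern x y \<partial>unit_square \<partial>unit_square))
    \<le> half_mean half_dim h * half_mean half_dim h + ?H * (3456 + 3456)"
    by (intro add_left_mono mult_left_mono add_mono nn_integral_kern_le) auto
  finally show ?thesis by simp
qed

text \<open>The diagonal is negligible and the integrand is symmetric, whence the factor 2. The
  quantifier over \<sigma> stands inside the almost sure statement because the limit runs through
  uncountably many \<sigma>.\<close>

lemma self_overlap_eq_half_overlap:
  "AE \<omega> in M. \<forall>\<sigma>>0. self_overlap B \<sigma> \<omega> = 2 * enn2real (half_overlap W (\<sigma>\<^sup>2) \<omega>)"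
  using version AE_space
proof eventually_elim
  case (elim \<omega>)
  note [measurable] = elim(2)
  show ?case
  proof (intro allI impI)
    fix \<sigma> :: real assume "\<sigma> > 0"
    then have h: "\<sigma>\<^sup>2 > 0" by simp
    define g where "g = (\<lambda>s t. bump (\<sigma>\<^sup>2) (W s \<omega> - W t \<omega>))"
    have [measurable]: "(\<lambda>x. g (f x) (k x)) \<in> borel_measurable N"
      if [measurable]: "f \<in> borel_measurable N" "k \<in> borel_measurable N" for f k and N :: "'z measure"
      unfolding g_def by measurable
    have g: "0 \<le> g s t" "g s t \<le> 1" "g s t = g t s" for s t
      using bump_le_1[OF h] bump_minus[of "\<sigma>\<^sup>2" "W s \<omega> - W t \<omega>"] by (auto simp: g_def)
    have "self_overlap B \<sigma> \<omega> = (LINT s:{0..1}|lborel. LINT t:{0..1}|lborel. g s t)"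
      unfolding self_overlap_def gauss_eq_bump g_def
      by (intro set_lebesgue_integral_cong) (auto intro!: set_lebesgue_integral_cong simp: elim(1))
    also have "\<dots> = (\<integral> s. \<integral> t. g s t \<partial>unit_law \<partial>unit_law)"
      by (simp add: set_integral_unit_law)
    also have "\<dots> = (\<integral> x. g (fst x) (snd x) \<partial>unit_square)"
    proof -
      have "integrable unit_square (\<lambda>x. g (fst x) (snd x))"
        by (rule unit_pair.integrable_const_bound[of _ 1]) (auto simp: g)
      from unit_pair.integral_fst'[OF this] show ?thesis by simp
    qed
    also have "\<dots> = enn2real (\<integral>\<^sup>+ x. g (fst x) (snd x) \<partial>unit_square)"
      by (rule integral_eq_nn_integral) (auto simp: g)
    also have "(\<integral>\<^sup>+ x. g (fst x) (snd x) \<partial>unit_square) = (\<integral>\<^sup>+ s. \<integral>\<^sup>+ t. g s t \<partial>unit_law \<partial>unit_law)"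
      by (simp add: unit_law.nn_integral_fst[symmetric])
    also have "\<dots> = (\<integral>\<^sup>+ s. \<integral>\<^sup>+ t. (if s < t then ennreal (g s t) else 0) + (if t < s then ennreal (g s t) else 0) \<partial>unit_law \<partial>unit_law)"
    proof (rule nn_integral_cong, rule nn_integral_cong_AE)
      show "AE t in unit_law. ennreal (g s t) = (if s < t then ennreal (g s t) else 0) + (if t < s then ennreal (g s t) else 0)" for s
        using AE_unit_law_neq[of s] by eventually_elim auto
    qed
    also have "\<dots> = (\<integral>\<^sup>+ s. (\<integral>\<^sup>+ t. (if s < t then ennreal (g s t) else 0) \<partial>unit_law) + (\<integral>\<^sup>+ t. (if t < s then ennreal (g s t) else 0) \<partial>unit_law) \<partial>unit_law)"
      by (rule nn_integral_cong, rule nn_integral_add) measurable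
    also have "\<dots> = (\<integral>\<^sup>+ s. \<integral>\<^sup>+ t. (if s < t then ennreal (g s t) else 0) \<partial>unit_law \<partial>unit_law)
        + (\<integral>\<^sup>+ s. \<integral>\<^sup>+ t. (if t < s then ennreal (g s t) else 0) \<partial>unit_law \<partial>unit_law)"
      by (intro nn_integral_add) measurable
    also have "(\<integral>\<^sup>+ s. \<integral>\<^sup>+ t. (if t < s then ennreal (g s t) else 0) \<partial>unit_law \<partial>unit_law)
       = (\<integral>\<^sup>+ s. \<integral>\<^sup>+ t. (if s < t then ennreal (g t s) else 0) \<partial>unit_law \<partial>unit_law)"
      by (rule unit_pair.Fubini') measurable
    also have "\<dots> = (\<integral>\<^sup>+ s. \<integral>\<^sup>+ t. (if s < t then ennreal (g s t) else 0) \<partial>unit_law \<partial>unit_law)"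
      by (simp only: g(3))
    also have "(\<integral>\<^sup>+ s. \<integral>\<^sup>+ t. (if s < t then ennreal (g s t) else 0) \<partial>unit_law \<partial>unit_law) = half_overlap W (\<sigma>\<^sup>2) \<omega>"
      unfolding half_overlap_def
      by (subst unit_law.nn_integral_fst[symmetric]) (auto simp: ordered_bump_def g(3)[unfolded g_def] g_def intro!: nn_integral_cong)
    finally show "self_overlap B \<sigma> \<omega> = 2 * enn2real (half_overlap W (\<sigma>\<^sup>2) \<omega>)"
      by (simp add: enn2real_mult flip: mult_2)
  qed
qed

text \<open>Since the half overlap is at most 1, it is a square integrable real variable, and the
  square of its mean can be subtracted from the second moment. The factor 2 contributes 4 to the
  variance: 27648 = 4 * 6912.\<close>

lemma half_overlap_variance:
  assumes q: "CARD('d) = 2 \<and> q = 1 \<or> CARD('d) \<ge> 3 \<and> q = 9/8" and h: "0 < h"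
  shows "(\<integral>\<^sup>+ \<omega>. ennreal ((2 * enn2real (half_overlap W h \<omega>) - 2 * enn2real (half_mean half_dim h))\<^sup>2) \<partial>M)
     \<le> ennreal (27648 * h powr (2 * q))"
proof -
  define X where "X = (\<lambda>\<omega>. enn2real (half_overlap W h \<omega>))"
  have Q: "half_overlap W h \<omega> = ennreal (X \<omega>)" for \<omega>
    using half_overlap_le_1[OF h, of W \<omega>] unfolding X_def by (intro ennreal_enn2real[symmetric]) (auto simp: le_less_trans)
  have X: "0 \<le> X \<omega>" "X \<omega> \<le> 1" for \<omega>
    using half_overlap_le_1[OF h, of W \<omega>] by (auto simp: X_def intro: enn2real_leI)
  have [measurable]: "X \<in> borel_measurable M" unfolding X_def by measurable
  have iX: "integrable M X" by (rule integrable_const_bound[of _ 1]) (auto simp: X)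
  have iX2: "integrable M (\<lambda>\<omega>. (X \<omega>)\<^sup>2)" by (rule integrable_const_bound[of _ 1]) (auto simp: X abs_square_le_1)
  define \<mu> where "\<mu> = expectation X"
  have mu: "half_mean half_dim h = ennreal \<mu>"
    unfolding nn_integral_half_overlap[OF h, symmetric] Q \<mu>_def using X by (intro nn_integral_eq_integral iX) auto
  have mu0: "0 \<le> \<mu>" unfolding \<mu>_def using X by simp
  have "ennreal (expectation (\<lambda>\<omega>. (X \<omega>)\<^sup>2)) = (\<integral>\<^sup>+ \<omega>. ennreal ((X \<omega>)\<^sup>2) \<partial>M)"
    by (intro nn_integral_eq_integral[symmetric] iX2) auto
  also have "\<dots> = (\<integral>\<^sup>+ \<omega>. half_overlap W h \<omega> * half_overlap W h \<omega> \<partial>M)"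
    by (simp add: Q X power2_eq_square ennreal_mult)
  also have "\<dots> \<le> half_mean half_dim h * half_mean half_dim h + ennreal (h powr (2 * q)) * 6912"
    by (rule nn_integral_half_overlap_sq[OF q h])
  also have "\<dots> = ennreal (\<mu>\<^sup>2 + 6912 * h powr (2 * q))"
    using mu0 by (simp add: mu power2_eq_square ennreal_mult mult.commute)
  finally have le: "expectation (\<lambda>\<omega>. (X \<omega>)\<^sup>2) \<le> \<mu>\<^sup>2 + 6912 * h powr (2 * q)"
    by (subst (asm) ennreal_le_iff) auto
  have "(\<integral>\<^sup>+ \<omega>. ennreal ((2 * X \<omega> - 2 * \<mu>)\<^sup>2) \<partial>M) = ennreal (4 * variance X)"
    unfolding \<mu>_def[symmetric]
  proof -
    have i: "integrable M (\<lambda>\<omega>. (X \<omega> - \<mu>)\<^sup>2)"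
      using iX iX2 by (simp add: power2_diff)
    have "(\<integral>\<^sup>+ \<omega>. ennreal ((2 * X \<omega> - 2 * \<mu>)\<^sup>2) \<partial>M) = (\<integral>\<^sup>+ \<omega>. ennreal (4 * (X \<omega> - \<mu>)\<^sup>2) \<partial>M)"
      by (intro nn_integral_cong arg_cong[where f = ennreal]) (simp add: power2_eq_square algebra_simps)
    also have "\<dots> = ennreal (expectation (\<lambda>\<omega>. 4 * (X \<omega> - \<mu>)\<^sup>2))"
      by (rule nn_integral_eq_integral) (use i in auto)
    finally show "(\<integral>\<^sup>+ \<omega>. ennreal ((2 * X \<omega> - 2 * \<mu>)\<^sup>2) \<partial>M) = ennreal (4 * expectation (\<lambda>\<omega>. (X \<omega> - \<mu>)\<^sup>2))"
      by simp
  qed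
  also have "\<dots> \<le> ennreal (27648 * h powr (2 * q))"
    using le variance_eq[OF iX iX2] by (intro ennreal_leI) (simp add: \<mu>_def)
  finally show ?thesis using mu mu0 by (simp add: X_def)
qed

end

section \<open>Mean self-overlap\<close>

lemma half_mean_iterated:
  "half_mean p h = (\<integral>\<^sup>+ s. (\<integral>\<^sup>+ t. ennreal ((h / (h + (t - s))) powr p) * indicator {s..1} t \<partial>lborel) \<partial>unit_law)"
proof -
  have "half_mean p h = (\<integral>\<^sup>+ s. \<integral>\<^sup>+ t. mean_kern p h (s, t) \<partial>unit_law \<partial>unit_law)"
    unfolding half_mean_def by (simp add: unit_law.nn_integral_fst[symmetric])
  also have "\<dots> = (\<integral>\<^sup>+ s. (\<integral>\<^sup>+ t. ennreal ((h / (h + (t - s))) powr p) * indicator {s..1} t \<partial>lborel) \<partial>unit_law)"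
  proof (rule nn_integral_cong_AE)
    show "AE s in unit_law. (\<integral>\<^sup>+ t. mean_kern p h (s, t) \<partial>unit_law) = (\<integral>\<^sup>+ t. ennreal ((h / (h + (t - s))) powr p) * indicator {s..1} t \<partial>lborel)"
      using AE_unit_law_mem
    proof eventually_elim
      case (elim s)
      have [measurable]: "(\<lambda>t. mean_kern p h (s, t)) \<in> borel_measurable borel"
        unfolding mean_kern_def by measurable
      show ?case
        unfolding nn_integral_unit_law[OF \<open>(\<lambda>t. mean_kern p h (s, t)) \<in> borel_measurable borel\<close>]
      proof (rule nn_integral_cong_AE)
        show "AE t in lborel. mean_kern p h (s, t) * indicator {0..1} t = ennreal ((h / (h + (t - s))) powr p) * indicator {s..1} t"
          using AE_lborel_singleton[of s]
          by eventually_elim (use elim in \<open>auto simp: mean_kern_def indicator_def\<close>)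
      qed
    qed
  qed
  finally show ?thesis .
qed

lemma inner_mean_powr:
  fixes h p s :: real
  assumes "0 < h" "1 < p" "s \<le> 1"
  shows "(\<integral>\<^sup>+ t. ennreal ((h / (h + (t - s))) powr p) * indicator {s..1} t \<partial>lborel)
     = ennreal (h * (1 - (h / (h + (1 - s))) powr (p - 1)) / (p - 1))"
proof -
  define F where "F = (\<lambda>t. - (h powr p * (h + (t - s)) powr (1 - p)) / (p - 1))"
  have "(\<integral>\<^sup>+ t. ennreal ((h / (h + (t - s))) powr p) * indicator {s..1} t \<partial>lborel) = ennreal (F 1 - F s)"
  proof (rule nn_integral_FTC_Icc)
    fix t assume t: "t \<in> {s..1}"
    show "(F has_real_derivative (h / (h + (t - s))) powr p) (at t)"
      unfolding F_def using assms t
      by (auto intro!: derivative_eq_intros simp: powr_divide powr_minus_divide divide_simps)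
         (simp add: algebra_simps)
  qed (use assms in auto)
  also have "F 1 - F s = h * (1 - (h / (h + (1 - s))) powr (p - 1)) / (p - 1)"
  proof -
    have "h powr p * h powr (1 - p) = h" using assms by (simp flip: powr_add)
    moreover have "h powr p * (h + (1 - s)) powr (1 - p) = h * (h / (h + (1 - s))) powr (p - 1)"
    proof -
      have "h powr p = h * h powr (p - 1)" using assms by (simp add: powr_diff)
      moreover have "(h + (1 - s)) powr (1 - p) = 1 / (h + (1 - s)) powr (p - 1)"
        using powr_minus_divide[of "h + (1 - s)" "p - 1"] by simp
      ultimately show ?thesis using assms by (simp add: powr_divide)
    qed
    ultimately show ?thesis by (simp add: F_def right_diff_distrib diff_divide_distrib)
  qed
  finally show ?thesis .
qed

text \<open>Dimension 2 is the exponent p = 1, where the power antiderivative degenerates to a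
  logarithm. This is the source of the extra factor in the normalisation.\<close>

lemma inner_mean_log:
  fixes h s :: real
  assumes "0 < h" "s \<le> 1"
  shows "(\<integral>\<^sup>+ t. ennreal ((h / (h + (t - s))) powr 1) * indicator {s..1} t \<partial>lborel)
     = ennreal (h * (ln (h + (1 - s)) - ln h))"
proof -
  define F where "F = (\<lambda>t. h * ln (h + (t - s)))"
  have "(\<integral>\<^sup>+ t. ennreal ((h / (h + (t - s))) powr 1) * indicator {s..1} t \<partial>lborel) = ennreal (F 1 - F s)"
  proof (rule nn_integral_FTC_Icc)
    fix t assume t: "t \<in> {s..1}"
    show "(F has_real_derivative (h / (h + (t - s))) powr 1) (at t)"
      unfolding F_def using assms t by (auto intro!: derivative_eq_intros)
  qed (use assms in auto)
  then show ?thesis by (simp add: F_def right_diff_distrib)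
qed

lemma nn_integral_unit_law_cong:
  assumes "\<And>t. 0 \<le> t \<Longrightarrow> t \<le> 1 \<Longrightarrow> f t = g t"
  shows "(\<integral>\<^sup>+ t. f t \<partial>unit_law) = (\<integral>\<^sup>+ t. g t \<partial>unit_law)"
  using AE_unit_law_mem by (rule nn_integral_cong_AE[OF eventually_mono]) (use assms in auto)

lemma half_mean_log:
  assumes h: "0 < h"
  shows "half_mean 1 h = ennreal (h * ((h + 1) * ln (h + 1) - 1 - h * ln h - ln h))"
proof -
  define G where "G = (\<lambda>s. h * (- ((h + (1 - s)) * ln (h + (1 - s)) - (h + (1 - s))) - s * ln h))"
  have "half_mean 1 h = (\<integral>\<^sup>+ s. ennreal (h * (ln (h + (1 - s)) - ln h)) \<partial>unit_law)"
    unfolding half_mean_iterated using inner_mean_log[OF h]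
    by (intro nn_integral_unit_law_cong) simp
  also have "\<dots> = (\<integral>\<^sup>+ s. ennreal (h * (ln (h + (1 - s)) - ln h)) * indicator {0..1} s \<partial>lborel)"
    by (rule nn_integral_unit_law) measurable
  also have "\<dots> = ennreal (G 1 - G 0)"
  proof (rule nn_integral_FTC_Icc)
    fix s :: real assume s: "s \<in> {0..1}"
    show "(G has_real_derivative h * (ln (h + (1 - s)) - ln h)) (at s)"
      unfolding G_def using h s by (auto intro!: derivative_eq_intros)
    show "0 \<le> h * (ln (h + (1 - s)) - ln h)" using h s by simp
  qed auto
  also have "G 1 - G 0 = h * ((h + 1) * ln (h + 1) - 1 - h * ln h - ln h)"
    by (simp add: G_def algebra_simps)
  finally show ?thesis .
qed

text \<open>The leading term of \<open>half_mean 1 h\<close> is - h * ln h, which for h = \<sigma>^2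
  is 2 * \<sigma>^2 * ln (1 / \<sigma>); the factor 2 in front makes the limit 4.\<close>

lemma half_mean_log_asymp:
  "((\<lambda>\<sigma>. 2 * enn2real (half_mean 1 (\<sigma>\<^sup>2)) / (\<sigma>\<^sup>2 * ln (1 / \<sigma>))) \<longlongrightarrow> 4) (at_right 0)"
proof -
  have "((\<lambda>\<sigma>::real. 2 * (\<sigma>\<^sup>2 * ((\<sigma>\<^sup>2 + 1) * ln (\<sigma>\<^sup>2 + 1) - 1 - \<sigma>\<^sup>2 * ln (\<sigma>\<^sup>2) - ln (\<sigma>\<^sup>2))) / (\<sigma>\<^sup>2 * ln (1 / \<sigma>))) \<longlongrightarrow> 4) (at_right 0)"
    by real_asymp
  \<comment> \<open>The sign is required because \<open>ennreal\<close> truncates negative reals to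
    0, so \<open>enn2real\<close> would not return the closed form.\<close>
  moreover have "\<forall>\<^sub>F \<sigma> in at_right (0::real). 0 \<le> \<sigma>\<^sup>2 * ((\<sigma>\<^sup>2 + 1) * ln (\<sigma>\<^sup>2 + 1) - 1 - \<sigma>\<^sup>2 * ln (\<sigma>\<^sup>2) - ln (\<sigma>\<^sup>2))"
    by real_asymp
  then have "\<forall>\<^sub>F \<sigma> in at_right 0. 2 * (\<sigma>\<^sup>2 * ((\<sigma>\<^sup>2 + 1) * ln (\<sigma>\<^sup>2 + 1) - 1 - \<sigma>\<^sup>2 * ln (\<sigma>\<^sup>2) - ln (\<sigma>\<^sup>2))) / (\<sigma>\<^sup>2 * ln (1 / \<sigma>))
     = 2 * enn2real (half_mean 1 (\<sigma>\<^sup>2)) / (\<sigma>\<^sup>2 * ln (1 / \<sigma>))"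
    using eventually_at_right_less[of 0] by eventually_elim (simp add: half_mean_log)
  ultimately show ?thesis by (rule Lim_transform_eventually)
qed

text \<open>The lower bound integrates (h / (h + u)) powr (1/2), which dominates
  (h / (h + u)) powr (p - 1) and has an antiderivative covering p = 2 as well.\<close>
lemma half_mean_powr_bounds:
  assumes h: "0 < h" and p: "3/2 \<le> p"
  shows "half_mean p h \<le> ennreal (h / (p - 1))"
    and "ennreal (h * (1 + 2 * h - 2 * sqrt h * sqrt (h + 1)) / (p - 1)) \<le> half_mean p h"
proof -
  have eq: "half_mean p h = (\<integral>\<^sup>+ s. ennreal (h * (1 - (h / (h + (1 - s))) powr (p - 1)) / (p - 1)) \<partial>unit_law)"
    unfolding half_mean_iterated using inner_mean_powr[OF h, of p] p
    by (intro nn_integral_unit_law_cong) simp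
  also have "\<dots> \<le> (\<integral>\<^sup>+ s. ennreal (h / (p - 1)) \<partial>unit_law)"
    using p h by (intro nn_integral_mono ennreal_leI divide_right_mono) (auto intro!: mult_left_le)
  finally show "half_mean p h \<le> ennreal (h / (p - 1))"
    using unit_law.emeasure_space_1 by simp
  define l where "l = (\<lambda>s. h * (1 - sqrt h / sqrt (h + (1 - s))) / (p - 1))"
  define G where "G = (\<lambda>s. h * (s + 2 * sqrt h * sqrt (h + (1 - s))) / (p - 1))"
  have "ennreal (G 1 - G 0) = (\<integral>\<^sup>+ s. ennreal (l s) * indicator {0..1} s \<partial>lborel)"
  proof (rule nn_integral_FTC_Icc[symmetric])
    fix s :: real assume s: "s \<in> {0..1}"
    show "(G has_real_derivative l s) (at s)"
    proof -
      have "((\<lambda>s. h + (1 - s)) has_real_derivative - 1) (at s)"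
        by (auto intro!: derivative_eq_intros)
      from DERIV_chain2[OF DERIV_real_sqrt this]
      have "((\<lambda>s. sqrt (h + (1 - s))) has_real_derivative inverse (sqrt (h + (1 - s))) / 2 * - 1) (at s)"
        using h s by simp
      then have D: "((\<lambda>s. s + 2 * sqrt h * sqrt (h + (1 - s))) has_real_derivative
          1 + 2 * sqrt h * (inverse (sqrt (h + (1 - s))) / 2 * - 1)) (at s)"
        by (intro DERIV_add DERIV_ident DERIV_cmult)
      have "1 + 2 * a * (inverse r / 2 * - 1) = 1 - a / r" for a r :: real
        by (simp add: inverse_eq_divide)
      from D[unfolded this] have "((\<lambda>s. s + 2 * sqrt h * sqrt (h + (1 - s))) has_real_derivative 1 - sqrt h / sqrt (h + (1 - s))) (at s)" .
      from DERIV_cdivide[OF DERIV_cmult[OF this]] show ?thesis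
        by (simp add: G_def l_def)
    qed
    show "0 \<le> l s" unfolding l_def using h s p by (auto intro!: divide_nonneg_nonneg mult_nonneg_nonneg)
  qed (auto simp: l_def)
  also have "\<dots> = (\<integral>\<^sup>+ s. ennreal (l s) \<partial>unit_law)"
    by (rule nn_integral_unit_law[symmetric]) (simp add: l_def)
  also have "\<dots> \<le> half_mean p h"
    unfolding eq
  proof (rule nn_integral_unit_law_mono)
    fix s :: real assume s: "0 \<le> s" "s \<le> 1"
    have "(h / (h + (1 - s))) powr (p - 1) \<le> (h / (h + (1 - s))) powr (1/2)"
      using h s p by (intro powr_mono') auto
    also have "\<dots> = sqrt h / sqrt (h + (1 - s))"
      using h s by (simp add: powr_half_sqrt real_sqrt_divide)
    finally show "ennreal (l s) \<le> ennreal (h * (1 - (h / (h + (1 - s))) powr (p - 1)) / (p - 1))"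
      unfolding l_def using h p by (intro ennreal_leI divide_right_mono mult_left_mono) auto
  qed
  also have "G 1 - G 0 = h * (1 + 2 * h - 2 * sqrt h * sqrt (h + 1)) / (p - 1)"
  proof -
    have "sqrt h * sqrt h = h" using h by simp
    then have "h * (1 + 2 * sqrt h * sqrt (h + (1 - 1))) - h * (0 + 2 * sqrt h * sqrt (h + (1 - 0)))
      = h * (1 + 2 * h - 2 * sqrt h * sqrt (h + 1))"
      by (simp add: right_diff_distrib mult.assoc)
    then show ?thesis by (simp only: G_def diff_divide_distrib[symmetric])
  qed
  finally show "ennreal (h * (1 + 2 * h - 2 * sqrt h * sqrt (h + 1)) / (p - 1)) \<le> half_mean p h" .
qed

lemma half_mean_powr_asymp:
  assumes p: "3/2 \<le> p"
  shows "((\<lambda>\<sigma>. 2 * enn2real (half_mean p (\<sigma>\<^sup>2)) / \<sigma>\<^sup>2) \<longlongrightarrow> 2 / (p - 1)) (at_right 0)"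
proof (rule real_tendsto_sandwich)
  have "((\<lambda>\<sigma>::real. 1 + 2 * \<sigma>\<^sup>2 - 2 * \<sigma> * sqrt (\<sigma>\<^sup>2 + 1)) \<longlongrightarrow> 1) (at_right 0)"
    by real_asymp
  from tendsto_mult[OF tendsto_const[of "2 / (p - 1)"] this]
  show "((\<lambda>\<sigma>. 2 / (p - 1) * (1 + 2 * \<sigma>\<^sup>2 - 2 * \<sigma> * sqrt (\<sigma>\<^sup>2 + 1))) \<longlongrightarrow> 2 / (p - 1)) (at_right 0)"
    by simp
  show "\<forall>\<^sub>F \<sigma> in at_right 0. 2 / (p - 1) * (1 + 2 * \<sigma>\<^sup>2 - 2 * \<sigma> * sqrt (\<sigma>\<^sup>2 + 1)) \<le> 2 * enn2real (half_mean p (\<sigma>\<^sup>2)) / \<sigma>\<^sup>2"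
    using eventually_at_right_less[of 0]
  proof eventually_elim
    case (elim \<sigma>)
    \<comment> \<open>Finiteness has to be secured first: \<open>enn2real\<close> maps infinity to
      0, which would spoil the lower bound.\<close>
    have "half_mean p (\<sigma>\<^sup>2) < \<infinity>"
      using half_mean_powr_bounds(1)[of "\<sigma>\<^sup>2" p] elim p by (auto intro: le_less_trans)
    then have "\<sigma>\<^sup>2 * (1 + 2 * \<sigma>\<^sup>2 - 2 * \<sigma> * sqrt (\<sigma>\<^sup>2 + 1)) / (p - 1) \<le> enn2real (half_mean p (\<sigma>\<^sup>2))"
      using half_mean_powr_bounds(2)[of "\<sigma>\<^sup>2" p] elim p by (cases "half_mean p (\<sigma>\<^sup>2)") (auto simp: ennreal_le_iff)
    then show ?case using elim p by (simp add: field_simps)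
  qed
  show "\<forall>\<^sub>F \<sigma> in at_right 0. 2 * enn2real (half_mean p (\<sigma>\<^sup>2)) / \<sigma>\<^sup>2 \<le> 2 / (p - 1)"
    using eventually_at_right_less[of 0]
  proof eventually_elim
    case (elim \<sigma>)
    have "enn2real (half_mean p (\<sigma>\<^sup>2)) \<le> \<sigma>\<^sup>2 / (p - 1)"
      using half_mean_powr_bounds(1)[of "\<sigma>\<^sup>2" p] elim p by (intro enn2real_leI) auto
    then show ?case using elim p by (simp add: field_simps)
  qed
qed auto

section \<open>Almost sure convergence\<close>

text \<open>The sum of the squares has finite expectation, so it is finite almost surely and its
  terms tend to 0. This takes the place of Chebyshev with Borel-Cantelli.\<close>

lemma AE_tendsto_0_of_summable_second_moments:
  fixes X :: "nat \<Rightarrow> 'a \<Rightarrow> real"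
  assumes [measurable]: "\<And>n. X n \<in> borel_measurable M"
    and le: "\<And>n. (\<integral>\<^sup>+ \<omega>. ennreal ((X n \<omega>)\<^sup>2) \<partial>M) \<le> ennreal (v n)"
    and v: "\<And>n. 0 \<le> v n" "summable v"
  shows "AE \<omega> in M. (\<lambda>n. X n \<omega>) \<longlonglongrightarrow> 0"
proof -
  have "(\<integral>\<^sup>+ \<omega>. (\<Sum>n. ennreal ((X n \<omega>)\<^sup>2)) \<partial>M) = (\<Sum>n. \<integral>\<^sup>+ \<omega>. ennreal ((X n \<omega>)\<^sup>2) \<partial>M)"
    by (rule nn_integral_suminf) measurable
  also have "\<dots> \<le> (\<Sum>n. ennreal (v n))"
    by (intro suminf_le le) auto
  also have "\<dots> = ennreal (suminf v)"
    by (rule suminf_ennreal_eq) (use v in \<open>auto simp: summable_sums\<close>)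
  finally have "AE \<omega> in M. (\<Sum>n. ennreal ((X n \<omega>)\<^sup>2)) \<noteq> \<infinity>"
    by (intro nn_integral_PInf_AE) (auto simp: top_unique)
  then show ?thesis
  proof eventually_elim
    case (elim \<omega>)
    then have "summable (\<lambda>n. (X n \<omega>)\<^sup>2)"
      by (intro summable_suminf_not_top) auto
    from summable_LIMSEQ_zero[OF this] have "(\<lambda>n. sqrt ((X n \<omega>)\<^sup>2)) \<longlonglongrightarrow> sqrt 0"
      by (intro tendsto_intros)
    then show ?case by (simp add: tendsto_rabs_zero_iff)
  qed
qed

lemma geometric_bracket:
  fixes q \<sigma> :: real
  assumes "0 < q" "q < 1" "0 < \<sigma>" "\<sigma> < q ^ N"
  obtains n where "N \<le> n" "q ^ Suc n < \<sigma>" "\<sigma> \<le> q ^ n"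
proof -
  obtain m0 where "q ^ m0 < \<sigma>" using real_arch_pow_inv[of \<sigma> q] assms by auto
  define m where "m = (LEAST m. q ^ m < \<sigma>)"
  have m: "q ^ m < \<sigma>" unfolding m_def by (rule LeastI) fact
  have "q ^ N \<le> 1" using assms by (simp add: power_le_one)
  \<comment> \<open>The first power below \<sigma> cannot be \<open>q ^ 0\<close>, since \<sigma> <
    \<open>q ^ N\<close> \<le> 1; so it has a predecessor, which gives the upper end of the
    bracket.\<close>
  with m assms obtain n where n: "m = Suc n" by (cases m) auto
  have "\<not> q ^ n < \<sigma>" using not_less_Least[of n "\<lambda>m. q ^ m < \<sigma>"] n by (simp add: m_def)
  moreover have "N \<le> n"
  proof (rule ccontr)
    assume "\<not> N \<le> n"
    then have "q ^ N \<le> q ^ Suc n" using assms by (intro power_decreasing) auto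
    with m n assms show False by simp
  qed
  ultimately show ?thesis using m n that by auto
qed

text \<open>For \<sigma> between consecutive powers of q, monotonicity of f and r puts f \<sigma> /
  r \<sigma> between f (q^(n+1)) / r (q^n) and f (q^n) / r (q^(n+1)), which tend to L * q^2 and L /
  q^2. Both are near L for q near 1. Only the countable family q = 1 - 1 / (k + 2) is used, so that
  the assumed limits can be drawn from almost sure statements; \<delta> lets r be monotone near 0
  only.\<close>

lemma tendsto_at_right_of_geometric:
  fixes f r :: "real \<Rightarrow> real"
  assumes f: "\<And>x y. 0 < x \<Longrightarrow> x \<le> y \<Longrightarrow> f x \<le> f y" "\<And>x. 0 < x \<Longrightarrow> 0 \<le> f x"
    and r: "\<And>x y. 0 < x \<Longrightarrow> x \<le> y \<Longrightarrow> y < \<delta> \<Longrightarrow> r x \<le> r y" "\<And>x. 0 < x \<Longrightarrow> x < \<delta> \<Longrightarrow> 0 < r x" "0 < \<delta>"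
    and ratio: "\<And>q. 0 < q \<Longrightarrow> q < 1 \<Longrightarrow> (\<lambda>n. r (q ^ Suc n) / r (q ^ n)) \<longlonglongrightarrow> q\<^sup>2"
    and lim: "\<And>k::nat. (\<lambda>n. f ((1 - 1 / (real k + 2)) ^ n) / r ((1 - 1 / (real k + 2)) ^ n)) \<longlonglongrightarrow> L"
  shows "((\<lambda>\<sigma>. f \<sigma> / r \<sigma>) \<longlongrightarrow> L) (at_right 0)"
proof -
  define Q where "Q = (\<lambda>k::nat. 1 - 1 / (real k + 2))"
  have Q: "0 < Q k" "Q k < 1" for k by (auto simp: Q_def field_simps)
  have Q1: "Q \<longlonglongrightarrow> 1" unfolding Q_def by real_asymp
  have small: "\<forall>\<^sub>F n in sequentially. Q k ^ n < \<delta>" for k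
    using order_tendstoD(2)[OF LIMSEQ_power_zero[of "Q k"] r(3)] Q[of k] by simp
  have bracket: "\<forall>\<^sub>F \<sigma> in at_right 0. P (f \<sigma> / r \<sigma>)"
    if "\<forall>\<^sub>F n in sequentially. \<forall>\<sigma>. Q k ^ Suc n < \<sigma> \<longrightarrow> \<sigma> \<le> Q k ^ n \<longrightarrow> P (f \<sigma> / r \<sigma>)" for P k
  proof -
    from that obtain N where N: "\<And>n \<sigma>. N \<le> n \<Longrightarrow> Q k ^ Suc n < \<sigma> \<Longrightarrow> \<sigma> \<le> Q k ^ n \<Longrightarrow> P (f \<sigma> / r \<sigma>)"
      by (auto simp: eventually_sequentially)
    have "0 < Q k ^ N" using Q by simp
    then show ?thesis
    proof (rule eventually_at_rightI[rotated])
      fix \<sigma> assume "\<sigma> \<in> {0<..<Q k ^ N}"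
      then obtain n where "N \<le> n" "Q k ^ Suc n < \<sigma>" "\<sigma> \<le> Q k ^ n"
        using geometric_bracket[of "Q k" \<sigma> N] Q[of k] by auto
      then show "P (f \<sigma> / r \<sigma>)" by (rule N)
    qed
  qed
  have ratio': "(\<lambda>n. r (Q k ^ Suc n) / r (Q k ^ n)) \<longlonglongrightarrow> (Q k)\<^sup>2" for k
    by (rule ratio[OF Q])
  have lim': "(\<lambda>n. f (Q k ^ n) / r (Q k ^ n)) \<longlonglongrightarrow> L" for k
    using lim[of k] by (simp add: Q_def)
  show ?thesis
  proof (rule order_tendstoI)
    fix a assume a: "a < L"
    have "(\<lambda>k. L * (Q k)\<^sup>2) \<longlonglongrightarrow> L * 1\<^sup>2" by (intro tendsto_intros Q1)
    then have "\<forall>\<^sub>F k in sequentially. a < L * (Q k)\<^sup>2"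
      using a by (intro order_tendstoD(1)) auto
    then obtain k where k: "a < L * (Q k)\<^sup>2" by (auto dest: eventually_happens)
    have "(\<lambda>n. f (Q k ^ Suc n) / r (Q k ^ Suc n) * (r (Q k ^ Suc n) / r (Q k ^ n))) \<longlonglongrightarrow> L * (Q k)\<^sup>2"
      by (intro tendsto_mult ratio' filterlim_compose[OF lim' filterlim_Suc])
    from order_tendstoD(1)[OF this k] small[of k]
    have "\<forall>\<^sub>F n in sequentially. \<forall>\<sigma>. Q k ^ Suc n < \<sigma> \<longrightarrow> \<sigma> \<le> Q k ^ n \<longrightarrow> a < f \<sigma> / r \<sigma>"
    proof eventually_elim
      case (elim n)
      show ?case
      proof (intro allI impI)
        fix \<sigma> assume \<sigma>: "Q k ^ Suc n < \<sigma>" "\<sigma> \<le> Q k ^ n"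
        have pos: "0 < Q k ^ Suc n" "0 < Q k ^ n" using Q[of k] by auto
        have rpos: "0 < r (Q k ^ Suc n)" "0 < r \<sigma>" "r \<sigma> \<le> r (Q k ^ n)"
          using r pos \<sigma> elim(2) by auto
        have "a < f (Q k ^ Suc n) / r (Q k ^ n)" using elim(1) rpos by simp
        also have "\<dots> \<le> f \<sigma> / r \<sigma>"
          using f(1)[of "Q k ^ Suc n" \<sigma>] f(2)[of "\<sigma>"] rpos pos \<sigma> by (intro frac_le) auto
        finally show "a < f \<sigma> / r \<sigma>" .
      qed
    qed
    then show "\<forall>\<^sub>F \<sigma> in at_right 0. a < f \<sigma> / r \<sigma>" by (rule bracket)
  next
    fix a assume a: "L < a"
    have "(\<lambda>k. L / (Q k)\<^sup>2) \<longlonglongrightarrow> L / 1\<^sup>2" by (intro tendsto_intros Q1) simp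
    then have "\<forall>\<^sub>F k in sequentially. L / (Q k)\<^sup>2 < a"
      using a by (intro order_tendstoD(2)) auto
    then obtain k where k: "L / (Q k)\<^sup>2 < a" by (auto dest: eventually_happens)
    have "(\<lambda>n. (f (Q k ^ n) / r (Q k ^ n)) / (r (Q k ^ Suc n) / r (Q k ^ n))) \<longlonglongrightarrow> L / (Q k)\<^sup>2"
      using Q[of k] by (intro tendsto_divide ratio' lim') auto
    from order_tendstoD(2)[OF this k] small[of k]
    have "\<forall>\<^sub>F n in sequentially. \<forall>\<sigma>. Q k ^ Suc n < \<sigma> \<longrightarrow> \<sigma> \<le> Q k ^ n \<longrightarrow> f \<sigma> / r \<sigma> < a"
    proof eventually_elim
      case (elim n)
      show ?case
      proof (intro allI impI)
        fix \<sigma> assume \<sigma>: "Q k ^ Suc n < \<sigma>" "\<sigma> \<le> Q k ^ n"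
        have pos: "0 < Q k ^ Suc n" "0 < Q k ^ n" using Q[of k] by auto
        have rpos: "0 < r (Q k ^ Suc n)" "r (Q k ^ Suc n) \<le> r \<sigma>" "0 < r (Q k ^ n)"
          using r pos \<sigma> elim(2) by auto
        have "f \<sigma> / r \<sigma> \<le> f (Q k ^ n) / r (Q k ^ Suc n)"
          using f(1)[of \<sigma> "Q k ^ n"] f(2)[of "Q k ^ n"] rpos pos \<sigma> by (intro frac_le) auto
        also have "\<dots> < a" using elim(1) rpos by simp
        finally show "f \<sigma> / r \<sigma> < a" .
      qed
    qed
    then show "\<forall>\<^sub>F \<sigma> in at_right 0. f \<sigma> / r \<sigma> < a" by (rule bracket)
  qed
qed

lemma half_overlap_mono:
  assumes "0 < h" "h \<le> h'"
  shows "half_overlap W h \<omega> \<le> half_overlap W h' \<omega>"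
proof -
  have "bump h y \<le> bump h' y" for y :: "real ^ 'd"
    using assms by (simp add: bump_def frac_le)
  then show ?thesis
    unfolding half_overlap_def ordered_bump_def
    by (intro nn_integral_mono) (auto intro: ennreal_leI)
qed

section \<open>The limit for a general normalisation and its two instances\<close>

context measurable_version begin

text \<open>Common frame for both dimensions, which differ in the normalisation r, the variance
  exponent q and the limit of the means. The summability hypothesis is the variance bound divided by
  r^2 along a geometric sequence.\<close>

lemma AE_self_overlap_tendsto:
  assumes q: "CARD('d) = 2 \<and> q = 1 \<or> CARD('d) \<ge> 3 \<and> q = 9/8"
    and r: "\<And>x y. 0 < x \<Longrightarrow> x \<le> y \<Longrightarrow> y < \<delta> \<Longrightarrow> r x \<le> r y" "\<And>x. 0 < x \<Longrightarrow> x < \<delta> \<Longrightarrow> 0 < r x" "0 < \<delta>"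
    and ratio: "\<And>\<rho>. 0 < \<rho> \<Longrightarrow> \<rho> < 1 \<Longrightarrow> (\<lambda>n. r (\<rho> ^ Suc n) / r (\<rho> ^ n)) \<longlonglongrightarrow> \<rho>\<^sup>2"
    and summable: "\<And>\<rho>. 0 < \<rho> \<Longrightarrow> \<rho> < 1 \<Longrightarrow> summable (\<lambda>n. ((\<rho> ^ n)\<^sup>2) powr (2 * q) / (r (\<rho> ^ n))\<^sup>2)"
    and mean: "((\<lambda>\<sigma>. 2 * enn2real (half_mean half_dim (\<sigma>\<^sup>2)) / r \<sigma>) \<longlongrightarrow> L) (at_right 0)"
  shows "AE \<omega> in M. ((\<lambda>\<sigma>. self_overlap B \<sigma> \<omega> / r \<sigma>) \<longlongrightarrow> L) (at_right 0)"
proof -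
  define f where "f = (\<lambda>\<omega> \<sigma>. 2 * enn2real (half_overlap W (\<sigma>\<^sup>2) \<omega>))"
  define \<mu> where "\<mu> = (\<lambda>\<sigma>. 2 * enn2real (half_mean half_dim (\<sigma>\<^sup>2)))"
  define \<rho> where "\<rho> = (\<lambda>k::nat. 1 - 1 / (real k + 2))"
  have \<rho>: "0 < \<rho> k" "\<rho> k < 1" for k by (auto simp: \<rho>_def field_simps)
  have "AE \<omega> in M. (\<lambda>n. (f \<omega> (\<rho> k ^ n) - \<mu> (\<rho> k ^ n)) / r (\<rho> k ^ n)) \<longlonglongrightarrow> 0" for k
  proof (rule AE_tendsto_0_of_summable_second_moments)
    show "(\<lambda>\<omega>. (f \<omega> (\<rho> k ^ n) - \<mu> (\<rho> k ^ n)) / r (\<rho> k ^ n)) \<in> borel_measurable M" for n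
      unfolding f_def by measurable
    fix n
    let ?s = "\<rho> k ^ n"
    have "(\<integral>\<^sup>+ \<omega>. ennreal (((f \<omega> ?s - \<mu> ?s) / r ?s)\<^sup>2) \<partial>M)
       = (\<integral>\<^sup>+ \<omega>. ennreal (1 / (r ?s)\<^sup>2) * ennreal ((f \<omega> ?s - \<mu> ?s)\<^sup>2) \<partial>M)"
      by (intro nn_integral_cong) (simp add: power_divide flip: ennreal_mult)
    also have "\<dots> = ennreal (1 / (r ?s)\<^sup>2) * (\<integral>\<^sup>+ \<omega>. ennreal ((f \<omega> ?s - \<mu> ?s)\<^sup>2) \<partial>M)"
      unfolding f_def by (rule nn_integral_cmult) measurable
    also have "\<dots> \<le> ennreal (1 / (r ?s)\<^sup>2) * ennreal (27648 * (?s\<^sup>2) powr (2 * q))"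
      unfolding f_def \<mu>_def using \<rho>[of k] by (intro mult_left_mono half_overlap_variance[OF q]) auto
    also have "\<dots> = ennreal (27648 * ((?s\<^sup>2) powr (2 * q) / (r ?s)\<^sup>2))"
      by (simp flip: ennreal_mult)
    finally show "(\<integral>\<^sup>+ \<omega>. ennreal (((f \<omega> ?s - \<mu> ?s) / r ?s)\<^sup>2) \<partial>M) \<le> ennreal (27648 * ((?s\<^sup>2) powr (2 * q) / (r ?s)\<^sup>2))" .
  next
    show "summable (\<lambda>n. 27648 * (((\<rho> k ^ n)\<^sup>2) powr (2 * q) / (r (\<rho> k ^ n))\<^sup>2))"
      using summable[OF \<rho>[of k]] by (rule summable_mult)
  qed auto
  \<comment> \<open>A countable union of null sets is null; from here on \<omega> is fixed and the
    argument is deterministic.\<close>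
  then have "AE \<omega> in M. \<forall>k. (\<lambda>n. (f \<omega> (\<rho> k ^ n) - \<mu> (\<rho> k ^ n)) / r (\<rho> k ^ n)) \<longlonglongrightarrow> 0"
    by (simp add: AE_all_countable)
  with self_overlap_eq_half_overlap show ?thesis
  proof eventually_elim
    case (elim \<omega>)
    have "((\<lambda>\<sigma>. f \<omega> \<sigma> / r \<sigma>) \<longlongrightarrow> L) (at_right 0)"
    proof (rule tendsto_at_right_of_geometric[OF _ _ r ratio])
      fix x y :: real assume xy: "0 < x" "x \<le> y"
      then have "half_overlap W (x\<^sup>2) \<omega> \<le> half_overlap W (y\<^sup>2) \<omega>"
        by (intro half_overlap_mono) (auto intro: power_mono)
      moreover have "half_overlap W (y\<^sup>2) \<omega> < \<top>"
        using half_overlap_le_1[of "y\<^sup>2" W \<omega>] xy by (auto intro: le_less_trans)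
      ultimately show "f \<omega> x \<le> f \<omega> y" by (simp add: f_def enn2real_mono)
    next
      fix k :: nat
      have "filterlim (\<lambda>n. \<rho> k ^ n) (at_right 0) sequentially"
        unfolding filterlim_at using \<rho>[of k] by (auto intro: LIMSEQ_power_zero)
      from filterlim_compose[OF mean this]
      have "(\<lambda>n. \<mu> (\<rho> k ^ n) / r (\<rho> k ^ n)) \<longlonglongrightarrow> L"
        by (simp add: \<mu>_def)
      from tendsto_add[OF spec[OF elim(2), of k] this]
      have "(\<lambda>n. f \<omega> (\<rho> k ^ n) / r (\<rho> k ^ n)) \<longlonglongrightarrow> L"
        by (simp add: diff_divide_distrib)
      then show "(\<lambda>n. f \<omega> ((1 - 1 / (real k + 2)) ^ n) / r ((1 - 1 / (real k + 2)) ^ n)) \<longlonglongrightarrow> L"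
        by (simp add: \<rho>_def)
    qed (auto simp: f_def)
    moreover have "\<forall>\<^sub>F \<sigma> in at_right 0. f \<omega> \<sigma> / r \<sigma> = self_overlap B \<sigma> \<omega> / r \<sigma>"
      using eventually_at_right_less[of 0] by eventually_elim (use elim(1) in \<open>simp add: f_def\<close>)
    ultimately show ?case by (rule Lim_transform_eventually)
  qed
qed

text \<open>With h = \<sigma>^2 the normalised variance is at most a constant times h powr (9/4) /
  h^2 = \<sigma> powr (1/2), which gives a geometric series of ratio \<open>sqrt \<rho>\<close>. The
  limit of the means, 2 / (d / 2 - 1), is 4 / (d - 2).\<close>

lemma self_overlap_limit_ge3:
  assumes d: "CARD('d) \<ge> 3"
  shows "AE \<omega> in M. ((\<lambda>\<sigma>. self_overlap B \<sigma> \<omega> / \<sigma>\<^sup>2) \<longlongrightarrow> 4 / (real CARD('d) - 2)) (at_right 0)"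
proof (rule AE_self_overlap_tendsto[where q = "9/8" and \<delta> = 1])
  show "(\<lambda>n. (\<rho> ^ Suc n)\<^sup>2 / (\<rho> ^ n)\<^sup>2) \<longlonglongrightarrow> \<rho>\<^sup>2" if "0 < \<rho>" "\<rho> < 1" for \<rho> :: real
    using that by (simp add: power_mult_distrib)
  show "summable (\<lambda>n. ((\<rho> ^ n)\<^sup>2) powr (2 * (9/8)) / ((\<rho> ^ n)\<^sup>2)\<^sup>2)" if "0 < \<rho>" "\<rho> < 1" for \<rho> :: real
  proof -
    have "((\<rho> ^ n)\<^sup>2) powr (2 * (9/8)) / ((\<rho> ^ n)\<^sup>2)\<^sup>2 = sqrt \<rho> ^ n" for n
    proof -
      have pos: "0 < \<rho> ^ n" using that by simp
      then have "((\<rho> ^ n)\<^sup>2) powr (2 * (9/8)) / ((\<rho> ^ n)\<^sup>2)\<^sup>2 = (\<rho> ^ n) powr (9/2) / (\<rho> ^ n) powr 4"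
        by (simp add: powr_powr flip: powr_numeral)
      also have "\<dots> = (\<rho> ^ n) powr (1/2)" by (simp flip: powr_diff)
      also have "\<dots> = sqrt \<rho> ^ n" using pos by (simp add: powr_half_sqrt real_sqrt_power)
      finally show ?thesis .
    qed
    then show ?thesis using that by (simp add: summable_geometric)
  qed
  have p: "3/2 \<le> half_dim" and e: "2 / (half_dim - 1) = 4 / (real CARD('d) - 2)"
    using d by (auto simp: half_dim_def field_simps)
  show "((\<lambda>\<sigma>. 2 * enn2real (half_mean half_dim (\<sigma>\<^sup>2)) / \<sigma>\<^sup>2) \<longlongrightarrow> 4 / (real CARD('d) - 2)) (at_right 0)"
    using half_mean_powr_asymp[OF p] unfolding e .
qed (use d in \<open>auto intro: power_mono\<close>)

lemma self_overlap_limit_2: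
  assumes d: "CARD('d) = 2"
  shows "AE \<omega> in M. ((\<lambda>\<sigma>. self_overlap B \<sigma> \<omega> / (\<sigma>\<^sup>2 * ln (1 / \<sigma>))) \<longlongrightarrow> 4) (at_right 0)"
\<comment> \<open>The function z^2 * ln (1 / z) increases only while ln z \<le> -1/2; exp (- 1) is a
  convenient cutoff below that point.\<close>
proof (rule AE_self_overlap_tendsto[where q = 1 and \<delta> = "exp (- 1)"])
  fix x y :: real assume xy: "0 < x" "x \<le> y" "y < exp (- 1)"
  show "x\<^sup>2 * ln (1 / x) \<le> y\<^sup>2 * ln (1 / y)"
  proof (rule DERIV_nonneg_imp_nondecreasing[OF xy(2)])
    fix z assume z: "x \<le> z" "z \<le> y"
    have "ln z < ln (exp (- 1))" using z xy by (subst ln_less_cancel_iff) auto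
    then have "ln z < - 1" by simp
    then have "0 \<le> z * (- 2 * ln z - 1)" using z xy by (intro mult_nonneg_nonneg) auto
    moreover have "((\<lambda>z. z\<^sup>2 * ln (1 / z)) has_real_derivative z * (- 2 * ln z - 1)) (at z)"
    proof -
      have "ln (1 / z) = - ln z" using z xy by (simp add: ln_div)
      then show ?thesis
        using z xy by (auto intro!: derivative_eq_intros simp: power2_eq_square field_simps)
    qed
    ultimately show "\<exists>D. ((\<lambda>z. z\<^sup>2 * ln (1 / z)) has_real_derivative D) (at z) \<and> 0 \<le> D" by blast
  qed
next
  fix x :: real assume x: "0 < x" "x < exp (- 1)"
  moreover have "exp (- 1 :: real) < 1" by simp
  ultimately have "x < 1" by linarith
  then show "0 < x\<^sup>2 * ln (1 / x)" using x by (intro mult_pos_pos) (auto simp: ln_div)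
next
  fix \<rho> :: real assume \<rho>: "0 < \<rho>" "\<rho> < 1"
  then have ln_pow: "ln (1 / \<rho> ^ n) = - (real n * ln \<rho>)" "ln \<rho> < 0" for n
    by (auto simp: ln_div ln_realpow)
  have "(\<lambda>n. \<rho>\<^sup>2 * ((real n + 1) / real n)) \<longlonglongrightarrow> \<rho>\<^sup>2 * 1"
    by (intro tendsto_mult tendsto_const) real_asymp
  moreover have "\<forall>\<^sub>F n in sequentially. \<rho>\<^sup>2 * ((real n + 1) / real n)
      = (\<rho> ^ Suc n)\<^sup>2 * ln (1 / \<rho> ^ Suc n) / ((\<rho> ^ n)\<^sup>2 * ln (1 / \<rho> ^ n))"
    using eventually_gt_at_top[of 0]
  proof eventually_elim
    case (elim n)
    have "(\<rho> ^ Suc n)\<^sup>2 * ln (1 / \<rho> ^ Suc n) = (\<rho> ^ n)\<^sup>2 * (\<rho>\<^sup>2 * ((real n + 1) * - ln \<rho>))"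
      unfolding ln_pow by (simp add: power_mult_distrib)
    moreover have "(\<rho> ^ n)\<^sup>2 * ln (1 / \<rho> ^ n) = (\<rho> ^ n)\<^sup>2 * (real n * - ln \<rho>)"
      unfolding ln_pow by simp
    ultimately show ?case using \<rho> elim ln_pow(2) by simp
  qed
  ultimately show "(\<lambda>n. (\<rho> ^ Suc n)\<^sup>2 * ln (1 / \<rho> ^ Suc n) / ((\<rho> ^ n)\<^sup>2 * ln (1 / \<rho> ^ n))) \<longlonglongrightarrow> \<rho>\<^sup>2"
    using Lim_transform_eventually by fastforce
  \<comment> \<open>The powers of \<rho> cancel, and the squared logarithm in the normalisation
    alone yields the summable 1 / n^2. At n = 0 both sides are 0, by the convention for division by
    zero.\<close>
  have "((\<rho> ^ n)\<^sup>2) powr (2 * 1) / ((\<rho> ^ n)\<^sup>2 * ln (1 / \<rho> ^ n))\<^sup>2 = 1 / (ln \<rho>)\<^sup>2 * (1 / (real n)\<^sup>2)" for n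
    unfolding ln_pow using \<rho> by (simp add: power_mult_distrib powr_numeral)
  moreover have "summable (\<lambda>n. 1 / (real n)\<^sup>2)"
    using inverse_power_summable[of 2, where 'a = real] by (simp add: inverse_eq_divide)
  ultimately show "summable (\<lambda>n. ((\<rho> ^ n)\<^sup>2) powr (2 * 1) / ((\<rho> ^ n)\<^sup>2 * ln (1 / \<rho> ^ n))\<^sup>2)"
    by (simp only: summable_mult)
next
  have "half_dim = 1" using d by (simp add: half_dim_def)
  then show "((\<lambda>\<sigma>. 2 * enn2real (half_mean half_dim (\<sigma>\<^sup>2)) / (\<sigma>\<^sup>2 * ln (1 / \<sigma>))) \<longlongrightarrow> 4) (at_right 0)"
    using half_mean_log_asymp by simp
qed (use d in auto)

end

theorem theorem1p5:
  fixes M :: "'w measure" and B :: "real \<Rightarrow> 'w \<Rightarrow> real ^ 'd"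
  assumes "brownian_motion M B"
  shows "(CARD('d) \<ge> 3 \<longrightarrow>
            (AE \<omega> in M. ((\<lambda>\<sigma>. self_overlap B \<sigma> \<omega> / \<sigma>\<^sup>2)
               \<longlongrightarrow> 4 / (real CARD('d) - 2)) (at_right 0)))
       \<and> (CARD('d) = 2 \<longrightarrow>
            (AE \<omega> in M. ((\<lambda>\<sigma>. self_overlap B \<sigma> \<omega> / (\<sigma>\<^sup>2 * ln (1 / \<sigma>)))
               \<longlongrightarrow> 4) (at_right 0)))"
proof -
  interpret brownian_motion M B by fact
  obtain W where "(\<lambda>x. W (fst x) (snd x)) \<in> borel_measurable (borel \<Otimes>\<^sub>M M)"
    "AE \<omega> in M. \<forall>t\<in>{0..1}. W t \<omega> = B t \<omega>"
    using exists_jointly_measurable by blast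
  then interpret measurable_version M B W
    by unfold_locales
  show ?thesis
    using self_overlap_limit_ge3 self_overlap_limit_2 by blast
qed

end
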